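(* Consider, on an acyclic network, the AC economic dispatch problem: for $\alpha_i>0$ ($i\in\mathcal V_I$) and $\gamma^{(AC)}_{ij}\in[0,\pi/2)$ ($\{i,j\}\in\mathcal E$), minimize $f(u)=\sum_{i\in\mathcal V_I}\tfrac12\alpha_iu_i^2$ over $\theta\in\mathbb T^n$, $u\in\mathbb R^{n_I}$ subject to $$P_i^*+u_i=P_{\mathrm e,i}(\theta)\ \forall i\in\mathcal V_I,\quad P_i^*=P_{\mathrm e,i}(\theta)\ \forall i\in\mathcal V_L,\quad |\theta_i-\theta_j|\le\gamma^{(AC)}_{ij}\ \forall\{i,j\}\in\mathcal E,\quad P_{\mathrm e,i}(\theta)\in[0,\overline P_i]\ \forall i\in\mathcal V_I,$$ and the shifted control system $$0=\widetilde P_i-P_{\mathrm e,i}(\theta),\ i\in\mathcal V_L,\qquad D_i\dot\theta_i=\widetilde P_i-P_{\mathrm e,i}(\theta),\ i\in\mathcal V_I,$$ where $\widetilde P_i=P_i^*$ for $i\in\mathcal V_L$, $\widetilde P_i=P_i^*-D_i\,\omega_{\rm sync}$ for $i\in\mathcal V_I$, and $\omega_{\rm sync}=\sum_{i\in\mathcal V}P_i^*/\sum_{i\in\mathcal V_I}D_i$. The following statements are equivalent: (i) there are parameters $\alpha_i>0$, $i\in\mathcal V_I$, and $\gamma^{(AC)}_{ij}<\pi/2$, $\{i,j\}\in\mathcal E$, such that the AC economic dispatch problem is strictly feasible with global minimizer $(\theta^*,u^* )\in\mathbb T^n\times\mathbb R^{n_I}$; (ii) there exist $\gamma\in[0,\pi/2)$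 and droop coefficients $D_i>0$, $i\in\mathcal V_I$, so that the shifted control system possesses a unique and locally exponentially stable equilibrium manifold $[\theta]\subset\Delta_G(\gamma)$ meeting the injection constraints $0<P_{\mathrm e,i}(\theta)<\overline P_i$, $i\in\mathcal V_I$. If the equivalent statements (i) and (ii) are true, then the quantities in (i) and (ii) are related by: $[\theta^*]=[\theta]$, $u_i^*=-D_i\,\omega_{\rm sync}$ for $i\in\mathcal V_I$, $\gamma=\max_{\{i,j\}\in\mathcal E}\gamma^{(AC)}_{ij}$, and, for some $\beta>0$, $$D_i=\beta/\alpha_i,\qquad i\in\mathcal V_I.$$
   Context: Network: $G(\mathcal V,\mathcal E)$ is a connected, undirected, acyclic graph with node set $\mathcal V=\{1,\dots,n\}$ partitioned into loads and inverters, $\mathcal V=\mathcal V_L\cup\mathcal V_I$, $n_I=|\mathcal V_I|$. All lines are purely inductive: $\mathfrak{Im}(Y_{ij})=1/|z_{ij}|>0$ for $\{i,j\}\in\mathcal E$, and $Y_{ij}=0$ for $i\neq j$, $\{i,j\}\notin\mathcal E$. Voltage magnitudes $E_i>0$ are constant. $\theta\in\mathbb T^n$ is the vector of phase angles, and the active power injections are $P_{\mathrm e,i}(\theta)=\sum_{j=1}^n\mathfrak{Im}(Y_{ij})E_iE_j\sin(\theta_i-\theta_j)$. $P_i^*\in\mathbb R$ is the constant injection of load $i\in\mathcal V_L$. For $i\in\mathcal V_I$, $\overline P_i\ge0$ is the inverter rating and $P_i^*\in[0,\overline P_i]$ its nominal injection setpoint. Throughout, $0\le-\sum_{i\in\mathcal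 V_L}P_i^*\le\sum_{i\in\mathcal V_I}\overline P_i$. Strict feasibility: a pair $(\theta,u)$ is strictly feasible if it satisfies the equality constraints and all inequality constraints strictly ($|\theta_i-\theta_j|<\gamma^{(AC)}_{ij}$ and $0<P_{\mathrm e,i}(\theta)<\overline P_i$). "Strictly feasible with global minimizer $(\theta^*,u^* )$" means that the global minimizer is a strictly feasible pair. $\Delta_G(\gamma)$ is the interior of $\overline\Delta_G(\gamma)=\{\theta\in\mathbb T^n:\max_{\{i,j\}\in\mathcal E}|\theta_i-\theta_j|\le\gamma\}$, i.e. the set where all these distances are $<\gamma$; $|\theta_i-\theta_j|$ is the geodesic distance on the circle. $[\theta]$ denotes the orbit of $\theta\in\mathbb T^n$ under simultaneous rotation of all angles by the same angle. Equilibria come in such orbits (equilibrium manifolds), and uniqueness and (local exponential) stability are understood modulo this rotational symmetry and, for the differential-algebraic system, with respect to initial conditions consistent with the algebraic equations. *)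

theory Defs
  imports "HOL-Analysis.Analysis"
begin

text \<open>
  Nodes are the elements of a finite type, lines are two-element sets of nodes.
  \<open>setpoint\<close> is the constant injection of a load and the nominal injection of an inverter;
  the rating of a load is irrelevant.
\<close>

record 'n microgrid =
  loads :: "'n set"
  inverters :: "'n set"
  lines :: "'n set set"
  admittance :: "'n \<Rightarrow> 'n \<Rightarrow> complex"
  voltage :: "'n \<Rightarrow> real"
  setpoint :: "'n \<Rightarrow> real"
  rating :: "'n \<Rightarrow> real"

definition graph_connected :: "'n set set \<Rightarrow> bool" where
  "graph_connected E \<longleftrightarrow> (\<forall>i j. (i, j) \<in> {(a, b). {a, b} \<in> E}\<^sup>*)"

definition graph_cycle :: "'n set set \<Rightarrow> 'n list \<Rightarrow> bool" where
  "graph_cycle E c \<longleftrightarrow> length c \<ge> 3 \<and> distinct c \<and>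
     (\<forall>k < length c. {c ! k, c ! ((k + 1) mod length c)} \<in> E)"

definition graph_acyclic :: "'n set set \<Rightarrow> bool" where
  "graph_acyclic E \<longleftrightarrow> (\<nexists>c. graph_cycle E c)"

text \<open>
  There has to be at least one inverter, since otherwise the synchronization frequency
  would be \<open>0 / 0\<close>. The diagonal of the admittance matrix does not enter the power
  injections and is left unconstrained.
\<close>

definition acyclic_microgrid :: "'n::finite microgrid \<Rightarrow> bool" where
  "acyclic_microgrid N \<longleftrightarrow>
     loads N \<union> inverters N = UNIV \<and> loads N \<inter> inverters N = {} \<and> inverters N \<noteq> {} \<and>
     (\<forall>e \<in> lines N. card e = 2) \<and> graph_connected (lines N) \<and> graph_acyclic (lines N) \<and>
     (\<forall>i j. admittance N i j = admittance N j i) \<and>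
     (\<forall>i j. {i, j} \<in> lines N \<longrightarrow> Re (admittance N i j) = 0 \<and> Im (admittance N i j) > 0) \<and>
     (\<forall>i j. i \<noteq> j \<and> {i, j} \<notin> lines N \<longrightarrow> admittance N i j = 0) \<and>
     (\<forall>i. voltage N i > 0) \<and>
     (\<forall>i \<in> inverters N. 0 \<le> rating N i \<and> 0 \<le> setpoint N i \<and> setpoint N i \<le> rating N i) \<and>
     0 \<le> - (\<Sum>i \<in> loads N. setpoint N i) \<and>
     - (\<Sum>i \<in> loads N. setpoint N i) \<le> (\<Sum>i \<in> inverters N. rating N i)"

text \<open>
  Points of the torus are given by real representatives: all notions below are invariant under
  adding integer multiples of \<open>2 * pi\<close> to single angles. Subsets of the torus, in particular
  rotation orbits, are given by their full preimages in \<open>real ^ 'n\<close>; hence equality of orbits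
  is equality of these sets, and \<^const>\<open>infdist\<close> to an orbit is the distance in the flat torus.
\<close>

definition circle_dist :: "real \<Rightarrow> real \<Rightarrow> real" where
  "circle_dist x y = (INF k::int. \<bar>x - y + 2 * pi * of_int k\<bar>)"

definition rot_orbit :: "real ^ 'n::finite \<Rightarrow> (real ^ 'n) set" where
  "rot_orbit \<theta> = {\<phi>. \<exists>(s::real) (k::'n \<Rightarrow> int). \<forall>i. \<phi> $ i = \<theta> $ i + s + 2 * pi * of_int (k i)}"

definition cohesive_set :: "'n::finite microgrid \<Rightarrow> real \<Rightarrow> (real ^ 'n) set" where
  "cohesive_set N \<gamma> = {\<theta>. \<forall>i j. {i, j} \<in> lines N \<longrightarrow> circle_dist (\<theta> $ i) (\<theta> $ j) < \<gamma>}"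

definition power_injection :: "'n::finite microgrid \<Rightarrow> real ^ 'n \<Rightarrow> 'n \<Rightarrow> real" where
  "power_injection N \<theta> i =
     (\<Sum>j\<in>UNIV. Im (admittance N i j) * voltage N i * voltage N j * sin (\<theta> $ i - \<theta> $ j))"

text \<open>
  Vectors indexed by the inverters (\<open>u\<close>, \<open>\<alpha>\<close>, \<open>D\<close>) are functions on all nodes of which only the
  values at inverters matter; angle bounds \<open>\<gamma>\<close> are indexed by lines.
\<close>

definition dispatch_cost :: "'n::finite microgrid \<Rightarrow> ('n \<Rightarrow> real) \<Rightarrow> ('n \<Rightarrow> real) \<Rightarrow> real" where
  "dispatch_cost N \<alpha> u = (\<Sum>i\<in>inverters N. 1 / 2 * \<alpha> i * (u i)\<^sup>2)"

definition power_balance :: "'n::finite microgrid \<Rightarrow> real ^ 'n \<Rightarrow> ('n \<Rightarrow> real) \<Rightarrow> bool" where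
  "power_balance N \<theta> u \<longleftrightarrow>
     (\<forall>i\<in>inverters N. setpoint N i + u i = power_injection N \<theta> i) \<and>
     (\<forall>i\<in>loads N. setpoint N i = power_injection N \<theta> i)"

definition dispatch_feasible ::
    "'n::finite microgrid \<Rightarrow> ('n set \<Rightarrow> real) \<Rightarrow> real ^ 'n \<Rightarrow> ('n \<Rightarrow> real) \<Rightarrow> bool" where
  "dispatch_feasible N \<gamma> \<theta> u \<longleftrightarrow> power_balance N \<theta> u \<and>
     (\<forall>i j. {i, j} \<in> lines N \<longrightarrow> circle_dist (\<theta> $ i) (\<theta> $ j) \<le> \<gamma> {i, j}) \<and>
     (\<forall>i\<in>inverters N. 0 \<le> power_injection N \<theta> i \<and> power_injection N \<theta> i \<le> rating N i)"

definition dispatch_strictly_feasible ::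
    "'n::finite microgrid \<Rightarrow> ('n set \<Rightarrow> real) \<Rightarrow> real ^ 'n \<Rightarrow> ('n \<Rightarrow> real) \<Rightarrow> bool" where
  "dispatch_strictly_feasible N \<gamma> \<theta> u \<longleftrightarrow> power_balance N \<theta> u \<and>
     (\<forall>i j. {i, j} \<in> lines N \<longrightarrow> circle_dist (\<theta> $ i) (\<theta> $ j) < \<gamma> {i, j}) \<and>
     (\<forall>i\<in>inverters N. 0 < power_injection N \<theta> i \<and> power_injection N \<theta> i < rating N i)"

definition dispatch_minimizer ::
    "'n::finite microgrid \<Rightarrow> ('n \<Rightarrow> real) \<Rightarrow> ('n set \<Rightarrow> real) \<Rightarrow> real ^ 'n \<Rightarrow> ('n \<Rightarrow> real) \<Rightarrow> bool" where
  "dispatch_minimizer N \<alpha> \<gamma> \<theta> u \<longleftrightarrow> dispatch_feasible N \<gamma> \<theta> u \<and>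
     (\<forall>\<theta>' u'. dispatch_feasible N \<gamma> \<theta>' u' \<longrightarrow> dispatch_cost N \<alpha> u \<le> dispatch_cost N \<alpha> u')"

definition strict_optimal_dispatch ::
    "'n::finite microgrid \<Rightarrow> ('n \<Rightarrow> real) \<Rightarrow> ('n set \<Rightarrow> real) \<Rightarrow> real ^ 'n \<Rightarrow> ('n \<Rightarrow> real) \<Rightarrow> bool" where
  "strict_optimal_dispatch N \<alpha> \<gamma> \<theta> u \<longleftrightarrow>
     (\<forall>i\<in>inverters N. \<alpha> i > 0) \<and> (\<forall>e\<in>lines N. 0 \<le> \<gamma> e \<and> \<gamma> e < pi / 2) \<and>
     dispatch_strictly_feasible N \<gamma> \<theta> u \<and> dispatch_minimizer N \<alpha> \<gamma> \<theta> u"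

definition sync_freq :: "'n::finite microgrid \<Rightarrow> ('n \<Rightarrow> real) \<Rightarrow> real" where
  "sync_freq N D = (\<Sum>i\<in>UNIV. setpoint N i) / (\<Sum>i\<in>inverters N. D i)"

definition shifted_injection :: "'n::finite microgrid \<Rightarrow> ('n \<Rightarrow> real) \<Rightarrow> 'n \<Rightarrow> real" where
  "shifted_injection N D i =
     (if i \<in> inverters N then setpoint N i - D i * sync_freq N D else setpoint N i)"

definition consistent_state :: "'n::finite microgrid \<Rightarrow> ('n \<Rightarrow> real) \<Rightarrow> real ^ 'n \<Rightarrow> bool" where
  "consistent_state N D \<theta> \<longleftrightarrow>
     (\<forall>i\<in>loads N. 0 = shifted_injection N D i - power_injection N \<theta> i)"

text \<open>
  Solutions of the differential-algebraic system on a time interval \<open>J\<close>: the whole state is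
  continuous, but only the inverter angles are required to be differentiable.
\<close>

definition dae_solution ::
    "'n::finite microgrid \<Rightarrow> ('n \<Rightarrow> real) \<Rightarrow> real set \<Rightarrow> (real \<Rightarrow> real ^ 'n) \<Rightarrow> bool" where
  "dae_solution N D J \<theta> \<longleftrightarrow> continuous_on J \<theta> \<and>
     (\<forall>t\<in>J. consistent_state N D (\<theta> t)) \<and>
     (\<forall>t\<in>J. \<forall>i\<in>inverters N. \<exists>v. ((\<lambda>s. \<theta> s $ i) has_real_derivative v) (at t within J) \<and>
        D i * v = shifted_injection N D i - power_injection N (\<theta> t) i)"

definition equilibrium :: "'n::finite microgrid \<Rightarrow> ('n \<Rightarrow> real) \<Rightarrow> real ^ 'n \<Rightarrow> bool" where
  "equilibrium N D \<theta> \<longleftrightarrow> dae_solution N D UNIV (\<lambda>t. \<theta>)"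

definition equilibrium_manifold ::
    "'n::finite microgrid \<Rightarrow> ('n \<Rightarrow> real) \<Rightarrow> (real ^ 'n) set \<Rightarrow> bool" where
  "equilibrium_manifold N D M \<longleftrightarrow> (\<exists>\<theta>. M = rot_orbit \<theta>) \<and> (\<forall>\<theta>\<in>M. equilibrium N D \<theta>)"

text \<open>
  Besides the exponential estimate, which concerns all solutions on bounded or unbounded time
  intervals, stability includes that nearby consistent states are initial states of global solutions,
  so that the estimate is not vacuous.
\<close>

definition locally_exponentially_stable ::
    "'n::finite microgrid \<Rightarrow> ('n \<Rightarrow> real) \<Rightarrow> (real ^ 'n) set \<Rightarrow> bool" where
  "locally_exponentially_stable N D M \<longleftrightarrow>
     (\<exists>\<delta>>0. \<exists>c>0. \<exists>\<mu>>0. \<forall>\<theta>0. consistent_state N D \<theta>0 \<and> infdist \<theta>0 M < \<delta> \<longrightarrow>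
        (\<exists>\<theta>. \<theta> 0 = \<theta>0 \<and> dae_solution N D {0..} \<theta>) \<and>
        (\<forall>T>0. \<forall>\<theta>. \<theta> 0 = \<theta>0 \<and> dae_solution N D {0..<T} \<theta> \<longrightarrow>
           (\<forall>t\<in>{0..<T}. infdist (\<theta> t) M \<le> c * exp (- \<mu> * t) * infdist \<theta>0 M)))"

definition constrained_sync ::
    "'n::finite microgrid \<Rightarrow> real \<Rightarrow> ('n \<Rightarrow> real) \<Rightarrow> (real ^ 'n) set \<Rightarrow> bool" where
  "constrained_sync N \<gamma> D M \<longleftrightarrow>
     0 \<le> \<gamma> \<and> \<gamma> < pi / 2 \<and> (\<forall>i\<in>inverters N. D i > 0) \<and>
     equilibrium_manifold N D M \<and> M \<subseteq> cohesive_set N \<gamma> \<and>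
     (\<forall>M'. equilibrium_manifold N D M' \<and> M' \<subseteq> cohesive_set N \<gamma> \<longrightarrow> M' = M) \<and>
     locally_exponentially_stable N D M \<and>
     (\<forall>\<theta>\<in>M. \<forall>i\<in>inverters N. 0 < power_injection N \<theta> i \<and> power_injection N \<theta> i < rating N i)"

definition dispatch_droop_related ::
    "'n::finite microgrid \<Rightarrow> ('n \<Rightarrow> real) \<Rightarrow> ('n set \<Rightarrow> real) \<Rightarrow> real ^ 'n \<Rightarrow> ('n \<Rightarrow> real) \<Rightarrow>
     real \<Rightarrow> ('n \<Rightarrow> real) \<Rightarrow> (real ^ 'n) set \<Rightarrow> bool" where
  "dispatch_droop_related N \<alpha> \<gamma>AC \<theta> u \<gamma> D M \<longleftrightarrow>
     rot_orbit \<theta> = M \<and> (\<forall>i\<in>inverters N. u i = - D i * sync_freq N D) \<and>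
     \<gamma> = Max (\<gamma>AC ` lines N) \<and> (\<exists>\<beta>>0. \<forall>i\<in>inverters N. D i = \<beta> / \<alpha> i)"

end

theory Submission imports Defs begin

text \<open>
  A strictly feasible minimizer can be perturbed by shifting a little power from one inverter to
  another: on a forest every line flow below the line capacity is realised by an arcsine. Hence all
  marginal costs \<open>\<alpha> i * u i\<close> agree, which is the droop law with \<open>D i = 1 / \<alpha> i\<close>; conversely the
  droop law is sufficient for optimality by convexity, because the total control is prescribed.

  For stability, lift the angles so that all line differences lie in a compact subinterval of
  \<open>(- pi / 2, pi / 2)\<close> and continue the sine affinely outside of it. The flow map becomes globally
  Lipschitz and strongly monotone modulo rotations, so the load equations and the resulting
  ordinary differential equation are solved by the contraction principle. The quantity
  \<open>\<Sum>i\<in>I. D i * \<theta> i\<close> is conserved, and \<open>\<Sum>i\<in>I. D i * (\<theta> i - \<theta>s i)\<^sup>2\<close> decays exponentially around the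
  rotated equilibrium \<open>\<theta>s\<close> with the same value of that quantity; it does not involve derivatives of
  the load angles.
\<close>

subsection \<open>Forests and the torus\<close>

text \<open>The obstacle behind the stability claim is that solutions are assumed differentiable
  only in the inverter angles, so an energy in all angles cannot be differentiated along them. Two
  facts make the inverter angles sufficient. First, two load-consistent states have equal flows at
  every load, so pairing the flow difference with the inverter components alone gives the full
  pairing, to which monotonicity applies. Second, the whole difference of such states is bounded by
  a multiple of its inverter part, so decay of the inverter sum is decay of the state. Rotations are
  exactly what monotonicity does not see. Each initial state is therefore compared with the one
  rotated equilibrium that has the same \<open>D\<close>-weighted inverter mean; conservation of
  this mean keeps the comparison valid. Finally, the extended sine agrees with the sine only near
  the equilibrium, so the decay estimate is used twice: it also confines true solutions to the
  region where the two systems coincide.\<close>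

lemma rtrancl_distinct_path:
  assumes "(a, b) \<in> {(x, y). R x y}\<^sup>*"
  shows "\<exists>p. p \<noteq> [] \<and> hd p = a \<and> last p = b \<and> distinct p \<and> successively R p"
  using assms
proof (induction rule: converse_rtrancl_induct)
  case base
  show ?case by (rule exI[of _ "[b]"]) simp
next
  case (step a c)
  then obtain p where p: "p \<noteq> []" "hd p = c" "last p = b" "distinct p" "successively R p"
    by blast
  show ?case
  proof (cases "a \<in> set p")
    case True
    \<comment> \<open>The walk returns to \<open>a\<close>: the loop is cut off by keeping only the
      suffix that starts there.\<close>
    then obtain us vs where "p = us @ a # vs" by (meson split_list)
    with p show ?thesis
      by (intro exI[of _ "a # vs"]) (auto simp: successively_append_iff)
  next
    case False
    with p step show ?thesis
      by (intro exI[of _ "a # p"]) (auto simp: successively_Cons)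
  qed
qed

lemma graph_acyclic_subset: "graph_acyclic E \<Longrightarrow> E' \<subseteq> E \<Longrightarrow> graph_acyclic E'"
  unfolding graph_acyclic_def graph_cycle_def by blast

text \<open>A simple path around the edge would close up with it to a cycle. A path with only two
  vertices would be the deleted edge itself, so the cycle has the length 3 or more that
  \<open>graph_cycle\<close> demands.\<close>

lemma graph_acyclic_bridge:
  assumes acyclic: "graph_acyclic E" and edge: "{a, b} \<in> E" and "a \<noteq> b"
  shows "(a, b) \<notin> {(x, y). {x, y} \<in> E - {{a, b}}}\<^sup>*"
proof
  assume "(a, b) \<in> {(x, y). {x, y} \<in> E - {{a, b}}}\<^sup>*"
  from rtrancl_distinct_path[OF this] obtain p where p: "p \<noteq> []" "hd p = a" "last p = b"
    "distinct p" "successively (\<lambda>x y. {x, y} \<in> E - {{a, b}}) p" by blast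
  have step: "{p ! k, p ! Suc k} \<in> E - {{a, b}}" if "Suc k < length p" for k
    using p(5) that by (simp add: successively_conv_nth)
  have ends: "p ! 0 = a" "p ! (length p - 1) = b"
    using p by (simp_all add: hd_conv_nth last_conv_nth)
  have "length p \<noteq> 0" using p by simp
  moreover have "length p \<noteq> 1" using ends \<open>a \<noteq> b\<close> by auto
  moreover have "length p \<noteq> 2" using ends step[of 0] by auto
  ultimately have len: "length p \<ge> 3" by linarith
  have "{p ! k, p ! ((k + 1) mod length p)} \<in> E" if "k < length p" for k
  proof (cases "Suc k < length p")
    case True
    then show ?thesis using step[of k] by simp
  next
    case False
    with that have "k = length p - 1" by linarith
    moreover from this that have "(k + 1) mod length p = 0" by (metis Suc_eq_plus1 Suc_pred' gr_implies_not0 mod_self neq0_conv)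
    ultimately show ?thesis using ends edge by (simp add: insert_commute)
  qed
  with len p(4) have "graph_cycle E p" unfolding graph_cycle_def by blast
  with acyclic show False unfolding graph_acyclic_def by blast
qed

text \<open>Prescribed differences can conflict only around a cycle. The result serves both for
  lifted angle differences and for arcsines of line flows.\<close>

lemma forest_potential:
  fixes h :: "'a \<Rightarrow> 'a \<Rightarrow> 'b::ab_group_add"
  assumes "finite E" and "\<And>e. e \<in> E \<Longrightarrow> card e = 2" and "graph_acyclic E"
    and "\<And>i j. {i, j} \<in> E \<Longrightarrow> h i j = - h j i"
  obtains \<phi> where "\<And>i j. {i, j} \<in> E \<Longrightarrow> \<phi> i - \<phi> j = h i j"
proof -
  have "\<exists>\<phi>. \<forall>i j. {i, j} \<in> E \<longrightarrow> \<phi> i - \<phi> j = h i j"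
    using assms
  proof (induction E rule: finite_induct)
    case empty
    then show ?case by simp
  next
    case (insert e E)
    have "graph_acyclic E" using insert.prems(2) graph_acyclic_subset by blast
    with insert obtain \<phi> where \<phi>: "\<And>i j. {i, j} \<in> E \<Longrightarrow> \<phi> i - \<phi> j = h i j"
      by (metis insertCI)
    obtain a b where ab: "e = {a, b}" "a \<noteq> b"
      using insert.prems(1)[of e] by (auto simp: card_2_iff)
    define R where "R = {(x, y). {x, y} \<in> E}\<^sup>*"
    have "insert e E - {{a, b}} = E" using ab insert.hyps by auto
    then have not_ab: "(a, b) \<notin> R"
      using graph_acyclic_bridge[of "insert e E" a b] insert.prems(2) ab by (simp add: R_def)
    \<comment> \<open>The new edge joins two different components of the old forest. Shifting the
      whole component of \<open>a\<close> by the defect repairs this edge and alters no difference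
      along an old one.\<close>
    define \<psi> where "\<psi> x = (if (a, x) \<in> R then \<phi> x + (h a b - (\<phi> a - \<phi> b)) else \<phi> x)" for x
    have same: "(a, x) \<in> R \<longleftrightarrow> (a, y) \<in> R" if "{x, y} \<in> E" for x y
    proof -
      have "(x, y) \<in> R" "(y, x) \<in> R"
        using that by (auto simp: R_def insert_commute)
      then show ?thesis unfolding R_def by (meson rtrancl_trans)
    qed
    have aa: "(a, a) \<in> R" by (simp add: R_def)
    have ab_eq: "\<psi> a - \<psi> b = h a b" using aa not_ab by (simp add: \<psi>_def algebra_simps)
    have "\<psi> i - \<psi> j = h i j" if "{i, j} \<in> insert e E" for i j
    proof (cases "{i, j} \<in> E")
      case True
      then show ?thesis using \<phi>[OF True] same[OF True] by (auto simp: \<psi>_def)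
    next
      case False
      with that have "{i, j} = {a, b}" using ab by auto
      then consider "i = a" "j = b" | "i = b" "j = a" by (metis doubleton_eq_iff)
      then show ?thesis
      proof cases
        case 2
        have "h a b = - h b a" using insert.prems(3)[of a b] ab by auto
        with 2 ab_eq show ?thesis by (metis minus_diff_eq minus_minus)
      qed (use ab_eq in simp)
    qed
    then show ?case by blast
  qed
  with that show ?thesis by blast
qed

lemma graph_connected_invariant:
  assumes "graph_connected E" and "reflp R" and "transp R"
    and "\<And>i j. {i, j} \<in> E \<Longrightarrow> R i j"
  shows "R i j"
proof -
  have "(i, j) \<in> {(a, b). {a, b} \<in> E}\<^sup>*" using assms(1) by (simp add: graph_connected_def)
  then show ?thesis
    by (induction rule: rtrancl_induct) (use assms in \<open>auto dest: reflpD transpD\<close>)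
qed

text \<open>One unit is sent along a walk from \<open>i\<close> to \<open>j\<close>, line by line;
  at intermediate nodes inflow and outflow cancel. This is the direction of perturbation in the
  optimality argument.\<close>

lemma graph_connected_unit_flow:
  fixes i j :: "'n::finite"
  assumes "graph_connected E"
  obtains q :: "'n \<Rightarrow> 'n \<Rightarrow> real" where "\<And>a b. q a b = - q b a"
    and "\<And>a b. {a, b} \<notin> E \<Longrightarrow> q a b = 0"
    and "\<And>k. (\<Sum>b\<in>UNIV. q k b) = of_bool (k = i) - of_bool (k = j)"
proof -
  have "(i, j) \<in> {(a, b). {a, b} \<in> E}\<^sup>*" using assms by (simp add: graph_connected_def)
  then have "\<exists>q :: 'n \<Rightarrow> 'n \<Rightarrow> real. (\<forall>a b. q a b = - q b a) \<and> (\<forall>a b. {a, b} \<notin> E \<longrightarrow> q a b = 0) \<and>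
      (\<forall>k. (\<Sum>b\<in>UNIV. q k b) = of_bool (k = i) - of_bool (k = j))"
  proof (induction rule: rtrancl_induct)
    case base
    show ?case by (rule exI[of _ "\<lambda>a b. 0"]) simp
  next
    case (step y z)
    then obtain q :: "'n \<Rightarrow> 'n \<Rightarrow> real" where q: "\<forall>a b. q a b = - q b a" "\<forall>a b. {a, b} \<notin> E \<longrightarrow> q a b = 0"
      "\<forall>k. (\<Sum>b\<in>UNIV. q k b) = of_bool (k = i) - of_bool (k = y)" by blast
    define q' where "q' a b = q a b + of_bool (a = y) * of_bool (b = z) - of_bool (a = z) * of_bool (b = y)" for a b
    have "q' a b = - q' b a" for a b
      using q(1)[rule_format, of a b] by (simp add: q'_def)
    moreover have "q' a b = 0" if "{a, b} \<notin> E" for a b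
      using that q(2) step.hyps(2) by (auto simp: q'_def insert_commute)
    moreover have "(\<Sum>b\<in>UNIV. q' k b) = of_bool (k = i) - of_bool (k = z)" for k
    proof -
      have "(\<Sum>b\<in>UNIV. of_bool (b = c)) = (1::real)" for c :: 'n
        by (simp add: of_bool_def)
      then have "(\<Sum>b\<in>UNIV. q' k b) = (\<Sum>b\<in>UNIV. q k b) + of_bool (k = y) - of_bool (k = z)"
        by (simp add: q'_def sum.distrib sum_subtractf flip: sum_distrib_left)
      then show ?thesis using q(3) by simp
    qed
    ultimately show ?case by blast
  qed
  with that show ?thesis by metis
qed

section \<open>Circle distance and rotation orbits\<close>

lemma circle_dist_le: "circle_dist x y \<le> \<bar>x - y + 2 * pi * of_int k\<bar>"
  unfolding circle_dist_def
  by (rule cINF_lower) (auto intro!: bdd_belowI[of _ 0])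

lemma circle_dist_lessE:
  assumes "circle_dist x y < c"
  obtains k :: int where "\<bar>x - y + 2 * pi * of_int k\<bar> < c"
  using assms cInf_lessD[of "range (\<lambda>k::int. \<bar>x - y + 2 * pi * of_int k\<bar>)" c]
  unfolding circle_dist_def by auto

lemma rot_orbitE:
  assumes "\<phi> \<in> rot_orbit \<theta>"
  obtains s :: real and k :: "'n::finite \<Rightarrow> int"
  where "\<And>i. \<phi> $ i = \<theta> $ i + s + 2 * pi * of_int (k i)"
  using assms unfolding rot_orbit_def by auto

lemma rot_orbit_refl: "\<theta> \<in> rot_orbit \<theta>"
  unfolding rot_orbit_def by (auto intro!: exI[of _ 0] exI[of _ "\<lambda>i. 0"])

lemma rot_orbit_eq:
  assumes "\<phi> \<in> rot_orbit \<theta>"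
  shows "rot_orbit \<phi> = rot_orbit \<theta>"
proof -
  from assms obtain s k where sk: "\<And>i. \<phi> $ i = \<theta> $ i + s + 2 * pi * of_int (k i)"
    by (rule rot_orbitE) blast
  have "x \<in> rot_orbit \<theta>" if "x \<in> rot_orbit \<phi>" for x
  proof -
    from that obtain s' k' where "\<And>i. x $ i = \<phi> $ i + s' + 2 * pi * of_int (k' i)"
      by (rule rot_orbitE) blast
    then show ?thesis using sk unfolding rot_orbit_def
      by (auto simp: algebra_simps intro!: exI[of _ "s + s'"] exI[of _ "\<lambda>i. k i + k' i"])
  qed
  moreover have "x \<in> rot_orbit \<phi>" if "x \<in> rot_orbit \<theta>" for x
  proof -
    from that obtain s' k' where "\<And>i. x $ i = \<theta> $ i + s' + 2 * pi * of_int (k' i)"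
      by (rule rot_orbitE) blast
    then show ?thesis using sk unfolding rot_orbit_def
      by (auto simp: algebra_simps intro!: exI[of _ "s' - s"] exI[of _ "\<lambda>i. k' i - k i"])
  qed
  ultimately show ?thesis by blast
qed

lemma circle_dist_rotate:
  assumes "\<phi> \<in> rot_orbit \<theta>"
  shows "circle_dist (\<phi> $ i) (\<phi> $ j) = circle_dist (\<theta> $ i) (\<theta> $ j)"
proof -
  have le: "circle_dist (\<phi> $ i) (\<phi> $ j) \<le> circle_dist (\<theta> $ i) (\<theta> $ j)" if "\<phi> \<in> rot_orbit \<theta>"
    for \<phi> \<theta> :: "real ^ 'a"
  proof -
    from that obtain s k where sk: "\<And>i. \<phi> $ i = \<theta> $ i + s + 2 * pi * of_int (k i)"
      by (rule rot_orbitE) blast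
    have "circle_dist (\<phi> $ i) (\<phi> $ j) \<le> \<bar>\<theta> $ i - \<theta> $ j + 2 * pi * of_int l\<bar>" for l :: int
      using circle_dist_le[of "\<phi> $ i" "\<phi> $ j" "l - k i + k j"] by (simp add: sk algebra_simps)
    then show ?thesis unfolding circle_dist_def[of "\<theta> $ i"] by (intro cINF_greatest) auto
  qed
  from le[OF assms] le[of \<theta> \<phi>] show ?thesis
    using rot_orbit_eq[OF assms] rot_orbit_refl[of \<theta>] by auto
qed

lemma sin_add_int_periods: "sin (x + 2 * pi * of_int k) = sin (x::real)"
  using sin.plus_of_int[of x k] by (simp add: mult_ac)

lemma power_injection_rotate:
  assumes "\<phi> \<in> rot_orbit \<theta>"
  shows "power_injection N \<phi> = power_injection N \<theta>"
proof -
  from assms obtain s k where sk: "\<And>i. \<phi> $ i = \<theta> $ i + s + 2 * pi * of_int (k i)"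
    by (rule rot_orbitE) blast
  have "sin (\<phi> $ i - \<phi> $ j) = sin (\<theta> $ i - \<theta> $ j)" for i j
    using sin_add_int_periods[of "\<theta> $ i - \<theta> $ j" "k i - k j"] by (simp add: sk algebra_simps)
  then show ?thesis by (intro ext) (simp add: power_injection_def)
qed

text \<open>
  On a forest the representatives of all angle differences in \<open>(- pi, pi)\<close> can be realised
  simultaneously.
\<close>

lemma forest_lift:
  fixes \<theta> :: "real ^ 'n::finite"
  assumes E: "\<And>e. e \<in> E \<Longrightarrow> card e = 2" "graph_acyclic E" "graph_connected E"
    and c: "\<And>e. e \<in> E \<Longrightarrow> c e \<le> pi"
    and close: "\<And>i j. {i, j} \<in> E \<Longrightarrow> circle_dist (\<theta> $ i) (\<theta> $ j) < c {i, j}"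
  obtains \<phi> where "\<phi> \<in> rot_orbit \<theta>" and "\<And>i j. {i, j} \<in> E \<Longrightarrow> \<bar>\<phi> $ i - \<phi> $ j\<bar> < c {i, j}"
proof -
  have "\<exists>k. {i, j} \<in> E \<longrightarrow> \<bar>\<theta> $ i - \<theta> $ j + 2 * pi * of_int k\<bar> < c {i, j}" for i j
    using circle_dist_lessE[OF close] by metis
  then obtain k :: "'n \<Rightarrow> 'n \<Rightarrow> int"
    where k: "\<And>i j. {i, j} \<in> E \<Longrightarrow> \<bar>\<theta> $ i - \<theta> $ j + 2 * pi * of_int (k i j)\<bar> < c {i, j}"
    by metis
  \<comment> \<open>Both directed representatives are smaller than \<open>pi\<close> in modulus, so
    \<open>2 * pi\<close> times the integer \<open>k i j + k j i\<close> is smaller than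
    \<open>2 * pi\<close>, which forces the integer to be 0.\<close>
  have anti: "k i j = - k j i" if "{i, j} \<in> E" for i j
  proof -
    have "{j, i} \<in> E" "{j, i} = {i, j}" using that by (simp_all add: insert_commute)
    then have "\<bar>2 * pi * of_int (k i j + k j i)\<bar> < c {i, j} + c {i, j}"
      using k[of i j] k[of j i] that by (simp add: algebra_simps)
    also have "\<dots> \<le> 2 * pi" using c[OF that] by simp
    finally have "\<bar>real_of_int (k i j + k j i)\<bar> < 1" by (simp add: abs_mult)
    then show ?thesis by linarith
  qed
  obtain \<psi> where \<psi>: "\<And>i j. {i, j} \<in> E \<Longrightarrow> \<psi> i - \<psi> j = \<theta> $ i - \<theta> $ j + 2 * pi * of_int (k i j)"
  proof (rule forest_potential[of E "\<lambda>i j. \<theta> $ i - \<theta> $ j + 2 * pi * of_int (k i j)"])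
    show "finite E" by simp
    show "\<theta> $ i - \<theta> $ j + 2 * pi * of_int (k i j) = - (\<theta> $ j - \<theta> $ i + 2 * pi * of_int (k j i))"
      if "{i, j} \<in> E" for i j using anti[OF that] by simp
  qed (use E in auto)
  \<comment> \<open>Along a line, \<open>\<psi> - \<theta>\<close> changes only by full turns.
    Connectedness extends this to all pairs of nodes, so one real offset, taken at
    \<open>i0\<close>, remains as the rotation.\<close>
  define R where "R i j \<longleftrightarrow> (\<exists>l::int. (\<psi> i - \<theta> $ i) - (\<psi> j - \<theta> $ j) = 2 * pi * of_int l)" for i j
  have R: "R i j" for i j
  proof (rule graph_connected_invariant[OF E(3)])
    show "reflp R" by (auto simp: R_def intro!: reflpI exI[of _ 0])
    show "transp R"
    proof (rule transpI)
      fix x y z assume "R x y" "R y z"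
      then obtain l l' :: int where "(\<psi> x - \<theta> $ x) - (\<psi> y - \<theta> $ y) = 2 * pi * of_int l"
        "(\<psi> y - \<theta> $ y) - (\<psi> z - \<theta> $ z) = 2 * pi * of_int l'" unfolding R_def by blast
      then show "R x z" unfolding R_def by (intro exI[of _ "l + l'"]) (simp add: algebra_simps)
    qed
    show "R i j" if "{i, j} \<in> E" for i j
      unfolding R_def using \<psi>[OF that] by (intro exI[of _ "k i j"]) simp
  qed
  fix i0 :: 'n
  obtain l where l: "\<And>i. (\<psi> i - \<theta> $ i) - (\<psi> i0 - \<theta> $ i0) = 2 * pi * of_int (l i)"
    using R[of _ i0] unfolding R_def by metis
  show ?thesis
  proof (rule that[of "\<chi> i. \<psi> i"])
    show "(\<chi> i. \<psi> i) \<in> rot_orbit \<theta>"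
      unfolding rot_orbit_def using l by (auto simp: algebra_simps intro!: exI[of _ "\<psi> i0 - \<theta> $ i0"] exI[of _ l])
  qed (use \<psi> k in auto)
qed

subsection \<open>Globally Lipschitz differential equations\<close>

text \<open>Integrating the weight gains the factor \<open>1 / \<kappa>\<close>, which later makes
  the Picard operator contract.\<close>

lemma exp_integral_bound:
  fixes h :: "real \<Rightarrow> 'a::euclidean_space"
  assumes cont: "continuous_on UNIV h" and "\<kappa> > 0" and "0 \<le> t" and "0 \<le> C"
    and bound: "\<And>s. 0 \<le> s \<Longrightarrow> norm (h s) \<le> C * exp (\<kappa> * s)"
  shows "norm (integral {0..t} h) \<le> C * exp (\<kappa> * t) / \<kappa>"
proof -
  have "((\<lambda>s. C * exp (\<kappa> * s)) has_integral C * exp (\<kappa> * t) / \<kappa> - C * exp (\<kappa> * 0) / \<kappa>) {0..t}"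
    using assms(2,3)
    by (intro fundamental_theorem_of_calculus)
      (auto intro!: derivative_eq_intros simp flip: has_real_derivative_iff_has_vector_derivative)
  then have "norm (integral {0..t} h) \<le> C * exp (\<kappa> * t) / \<kappa> - C * exp (\<kappa> * 0) / \<kappa>"
    using bound integral_norm_bound_integral[of h "{0..t}" "\<lambda>s. C * exp (\<kappa> * s)"]
      integrable_continuous_interval[OF continuous_on_subset[OF cont], of 0 t]
    by (auto simp: has_integral_iff)
  also have "\<dots> \<le> C * exp (\<kappa> * t) / \<kappa>" using assms by simp
  finally show ?thesis .
qed

lemma indefinite_integral_has_vector_derivative:
  fixes h :: "real \<Rightarrow> 'a::euclidean_space"
  assumes "continuous_on UNIV h" and "0 \<le> t"
  shows "((\<lambda>t. integral {0..t} h) has_vector_derivative h t) (at t within {0..})"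
proof -
  have "((\<lambda>t. integral {0..t} h) has_vector_derivative h t) (at t within {0..t + 1})"
    using assms by (intro integral_has_vector_derivative) (auto intro: continuous_on_subset)
  moreover have "at t within {0..t + 1} = at t within {0..}"
    by (rule at_within_nhd[of _ "{..<t + 1}"]) auto
  ultimately show ?thesis by simp
qed

text \<open>
  The weight \<open>exp (- \<kappa> * t)\<close> with \<open>\<kappa>\<close> larger than the Lipschitz constant makes the Picard operator
  a contraction on the whole half line. Functions are extended constantly to negative times.
\<close>

lemma lipschitz_ode_global_solution:
  fixes F :: "'a::euclidean_space \<Rightarrow> 'a"
  assumes lip: "\<And>x y. norm (F x - F y) \<le> L * norm (x - y)"
  obtains y where "y 0 = y0"
    and "\<And>t. 0 \<le> t \<Longrightarrow> (y has_vector_derivative F (y t)) (at t within {0..})"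
proof -
  define \<kappa> where "\<kappa> = 2 * \<bar>L\<bar> + 1"
  have \<kappa>: "\<kappa> > 0" "\<bar>L\<bar> / \<kappa> \<le> 1 / 2" by (auto simp: \<kappa>_def field_simps)
  have lip': "norm (F x - F y) \<le> \<bar>L\<bar> * norm (x - y)" for x y
    using lip[of x y] mult_right_mono[OF abs_ge_self[of L] norm_ge_zero[of "x - y"]] by linarith
  have contF: "continuous_on UNIV F"
    using lip' by (intro lipschitz_onI[THEN lipschitz_on_continuous_on]) (auto simp: dist_norm)
  \<comment> \<open>The bounded function \<open>z\<close> stands for the solution scaled by
    \<open>exp (- \<kappa> * s)\<close>; the solution itself may grow exponentially and need not be
    bounded.\<close>
  define h where "h z s = F (exp (\<kappa> * s) *\<^sub>R apply_bcontfun z s)" for z :: "real \<Rightarrow>\<^sub>C 'a" and s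
  have conth: "continuous_on UNIV (h z)" for z
    unfolding h_def by (intro continuous_on_compose2[OF contF]) (auto intro!: continuous_intros)
  define G where "G z t = exp (- \<kappa> * max 0 t) *\<^sub>R (y0 + integral {0..max 0 t} (h z))"
    for z :: "real \<Rightarrow>\<^sub>C 'a" and t
  have contG: "continuous_on UNIV (G z)" for z
  proof -
    have "continuous_on {0..} (\<lambda>t. integral {0..t} (h z))"
      by (rule continuous_on_vector_derivative[of _ _ "h z"])
        (simp add: indefinite_integral_has_vector_derivative[OF conth])
    then have "continuous_on UNIV (\<lambda>t. integral {0..max 0 t} (h z))"
      by (rule continuous_on_compose2) (auto intro!: continuous_intros)
    then show ?thesis
      unfolding G_def by (intro continuous_intros)
  qed
  have diffG: "norm (G z t - G w t) \<le> 1 / 2 * dist z w" for z w t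
  proof -
    have "norm (h z s - h w s) \<le> (\<bar>L\<bar> * dist z w) * exp (\<kappa> * s)" for s
    proof -
      have "norm (h z s - h w s) \<le> \<bar>L\<bar> * norm (exp (\<kappa> * s) *\<^sub>R (apply_bcontfun z s - apply_bcontfun w s))"
        unfolding h_def using lip' by (simp add: scaleR_diff_right)
      also have "\<dots> \<le> \<bar>L\<bar> * (exp (\<kappa> * s) * dist z w)"
        using dist_bounded[of z s w] by (intro mult_left_mono) (auto simp: dist_norm)
      finally show ?thesis by (simp add: mult_ac)
    qed
    then have *: "norm (integral {0..max 0 t} (\<lambda>s. h z s - h w s))
        \<le> (\<bar>L\<bar> * dist z w) * exp (\<kappa> * max 0 t) / \<kappa>"
      using conth \<kappa> by (intro exp_integral_bound) (auto intro!: continuous_intros)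
    have int: "h z integrable_on {0..max 0 t}" for z
      by (intro integrable_continuous_interval continuous_on_subset[OF conth]) auto
    have "G z t - G w t = exp (- \<kappa> * max 0 t) *\<^sub>R integral {0..max 0 t} (\<lambda>s. h z s - h w s)"
      by (simp add: G_def integral_diff[OF int int] flip: scaleR_diff_right)
    then have "norm (G z t - G w t) \<le> exp (- \<kappa> * max 0 t) * ((\<bar>L\<bar> * dist z w) * exp (\<kappa> * max 0 t) / \<kappa>)"
      using mult_left_mono[OF *, of "exp (- \<kappa> * max 0 t)"] by simp
    also have "\<dots> = \<bar>L\<bar> / \<kappa> * dist z w" by (simp add: exp_minus field_simps)
    also have "\<dots> \<le> 1 / 2 * dist z w" using \<kappa> by (intro mult_right_mono) auto
    finally show ?thesis .
  qed
  \<comment> \<open>One bounded image suffices for \<open>G\<close> to preserve boundedness: the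
    contraction estimate controls the distance of every other image from it.\<close>
  have boundG0: "norm (G 0 t) \<le> norm y0 + norm (F 0) / \<kappa>" for t
  proof -
    have "norm (h 0 s) \<le> norm (F 0) * exp (\<kappa> * s)" if "0 \<le> s" for s
      using \<kappa> that mult_left_mono[of 1 "exp (\<kappa> * s)" "norm (F 0)"] by (simp add: h_def)
    then have "norm (integral {0..max 0 t} (h 0)) \<le> norm (F 0) * exp (\<kappa> * max 0 t) / \<kappa>"
      using conth \<kappa> by (intro exp_integral_bound) auto
    then have "norm (G 0 t) \<le> exp (- \<kappa> * max 0 t) * (norm y0 + norm (F 0) * exp (\<kappa> * max 0 t) / \<kappa>)"
      unfolding G_def by (auto intro!: mult_left_mono order_trans[OF norm_triangle_ineq])
    also have "\<dots> = exp (- \<kappa> * max 0 t) * norm y0 + norm (F 0) / \<kappa>"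
      by (simp add: exp_minus field_simps)
    also have "\<dots> \<le> norm y0 + norm (F 0) / \<kappa>"
      using \<kappa> by (auto intro!: mult_left_le_one_le)
    finally show ?thesis .
  qed
  have G_bcontfun: "G z \<in> bcontfun" for z
  proof (rule bcontfun_normI[OF contG])
    fix t
    have "norm (G z t) \<le> norm (G 0 t) + norm (G z t - G 0 t)"
      using norm_triangle_ineq[of "G 0 t" "G z t - G 0 t"] by simp
    then show "norm (G z t) \<le> norm y0 + norm (F 0) / \<kappa> + 1 / 2 * dist z 0"
      using boundG0[of t] diffG[of z t 0] by linarith
  qed
  have apply_G: "apply_bcontfun (Bcontfun (G z)) = G z" for z
    using G_bcontfun by (rule Bcontfun_inverse)
  have "dist (Bcontfun (G z)) (Bcontfun (G w)) \<le> 1 / 2 * dist z w" for z w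
    by (rule dist_bound) (simp only: apply_G dist_norm[where 'a = 'a] diffG)
  then have "\<exists>!z. Bcontfun (G z) = z"
    by (intro banach_fix_type[of "1 / 2"]) auto
  then obtain z where "Bcontfun (G z) = z" by blast
  then have fix_z: "apply_bcontfun z t = G z t" for t using apply_G by metis
  define y where "y t = y0 + integral {0..t} (h z)" for t
  have y: "exp (\<kappa> * t) *\<^sub>R apply_bcontfun z t = y t" if "0 \<le> t" for t
    using that by (simp add: fix_z G_def y_def exp_minus)
  show ?thesis
  proof (rule that[of y])
    show "y 0 = y0" by (simp add: y_def)
    show "(y has_vector_derivative F (y t)) (at t within {0..})" if "0 \<le> t" for t
    proof -
      have "(y has_vector_derivative h z t) (at t within {0..})"
        unfolding y_def using indefinite_integral_has_vector_derivative[OF conth that]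
        by (auto intro!: derivative_eq_intros)
      then show ?thesis using y[OF that] by (simp add: h_def)
    qed
  qed
qed

subsection \<open>Networks with strongly monotone couplings\<close>

text \<open>The minimum over the compact unit sphere is attained and positive; homogeneity of degree
  two carries it to all vectors.\<close>

lemma homogeneous_coercive:
  fixes S :: "'a::euclidean_space \<Rightarrow> real"
  assumes cont: "continuous_on UNIV S" and hom: "\<And>a w. S (a *\<^sub>R w) = a\<^sup>2 * S w"
    and pos: "\<And>w. w \<noteq> 0 \<Longrightarrow> S w > 0"
  obtains c where "c > 0" and "\<And>w. c * (norm w)\<^sup>2 \<le> S w"
proof -
  obtain v where v: "v \<in> sphere 0 1" "\<And>w. w \<in> sphere 0 1 \<Longrightarrow> S v \<le> S w"
    using continuous_attains_inf[of "sphere 0 1" S] cont continuous_on_subset by (metis compact_sphere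
      sphere_eq_empty not_one_less_zero subset_UNIV)
  show ?thesis
  proof (rule that[of "S v"])
    show "S v > 0" using v(1) pos[of v] by fastforce
    show "S v * (norm w)\<^sup>2 \<le> S w" for w
    proof (cases "w = 0")
      case True
      then show ?thesis using hom[of 0 w] by simp
    next
      case False
      then have "S v \<le> S ((1 / norm w) *\<^sub>R w)" by (intro v(2)) simp
      also have "\<dots> = S w / (norm w)\<^sup>2" by (simp only: hom) (simp add: power_divide)
      finally show ?thesis using False by (simp add: field_simps)
    qed
  qed
qed

text \<open>Summation by parts on a graph: exchanging the indices turns node values into differences
  along lines. Each line is met in both directions, whence the factor \<open>1 / 2\<close>.\<close>

lemma sum_antisymmetric_pairing:
  fixes f :: "'n::finite \<Rightarrow> 'n \<Rightarrow> real"
  assumes "\<And>i j. f i j = - f j i"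
  shows "(\<Sum>i\<in>UNIV. w i * (\<Sum>j\<in>UNIV. f i j)) = 1 / 2 * (\<Sum>i\<in>UNIV. \<Sum>j\<in>UNIV. f i j * (w i - w j))"
proof -
  have "(\<Sum>i\<in>UNIV. \<Sum>j\<in>UNIV. f i j * w j) = (\<Sum>i\<in>UNIV. \<Sum>j\<in>UNIV. f j i * w i)"
    by (rule sum.swap)
  also have "\<dots> = - (\<Sum>i\<in>UNIV. \<Sum>j\<in>UNIV. f i j * w i)"
    by (subst assms) (simp add: sum_negf)
  finally show ?thesis
    by (simp add: right_diff_distrib sum_subtractf sum_distrib_left mult.commute)
qed

definition restrict_vec :: "'n set \<Rightarrow> real ^ 'n \<Rightarrow> real ^ 'n::finite" where
  "restrict_vec I w = (\<chi> i. of_bool (i \<in> I) * w $ i)"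

lemma restrict_vec_nth [simp]: "restrict_vec I w $ i = (if i \<in> I then w $ i else 0)"
  by (simp add: restrict_vec_def)

lemma restrict_vec_diff: "restrict_vec I (v - w) = restrict_vec I v - restrict_vec I w"
  by (simp add: vec_eq_iff)

lemma restrict_vec_scaleR: "restrict_vec I (a *\<^sub>R w) = a *\<^sub>R restrict_vec I w"
  by (simp add: vec_eq_iff)

lemma norm_restrict_vec_le: "norm (restrict_vec I w) \<le> norm w"
  by (rule norm_le_componentwise_cart) simp

lemma continuous_on_restrict_vec [continuous_intros]:
  "continuous_on S f \<Longrightarrow> continuous_on S (\<lambda>x. restrict_vec I (f x))"
  unfolding restrict_vec_def by (intro continuous_intros)

lemma inner_restrict_vec: "restrict_vec I v \<bullet> w = v \<bullet> restrict_vec I w"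
  unfolding inner_vec_def by (rule sum.cong) auto

text \<open>The coupling function \<open>g\<close> is left open because the definition is used both
  with the sine and with its affine extension.\<close>

definition network_flow :: "('n \<Rightarrow> 'n \<Rightarrow> real) \<Rightarrow> (real \<Rightarrow> real) \<Rightarrow> real ^ 'n \<Rightarrow> real ^ 'n::finite" where
  "network_flow A g x = (\<chi> i. \<Sum>j\<in>UNIV. A i j * g (x $ i - x $ j))"

text \<open>Twice the quadratic form of the weighted graph Laplacian when \<open>A\<close> is
  symmetric, as ordered pairs are summed.\<close>

definition dirichlet_form :: "('n \<Rightarrow> 'n \<Rightarrow> real) \<Rightarrow> real ^ 'n::finite \<Rightarrow> real" where
  "dirichlet_form A w = (\<Sum>i\<in>UNIV. \<Sum>j\<in>UNIV. A i j * (w $ i - w $ j)\<^sup>2)"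

text \<open>A sector condition: all secant slopes of \<open>g\<close> lie between \<open>m\<close>
  and 1. The lower bound gives monotonicity, the upper one the Lipschitz estimate.\<close>

locale sector_network =
  fixes A :: "'n::finite \<Rightarrow> 'n \<Rightarrow> real" and g :: "real \<Rightarrow> real" and m :: real
  assumes sym: "A i j = A j i" and nonneg: "A i j \<ge> 0"
    and connected: "(i, j) \<in> {(a, b). A a b > 0}\<^sup>*"
    and odd: "g (- a) = - g a" and m_pos: "m > 0"
    and strongly_monotone: "m * (a - b)\<^sup>2 \<le> (g a - g b) * (a - b)"
    and nonexpansive: "\<bar>g a - g b\<bar> \<le> \<bar>a - b\<bar>"
begin

abbreviation "flow \<equiv> network_flow A g"
abbreviation "energy \<equiv> dirichlet_form A"

lemma flow_pairing:
  "w \<bullet> (flow x - flow y) = 1 / 2 *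
     (\<Sum>i\<in>UNIV. \<Sum>j\<in>UNIV. A i j * (g (x $ i - x $ j) - g (y $ i - y $ j)) * (w $ i - w $ j))"
proof -
  have "w \<bullet> (flow x - flow y) =
      (\<Sum>i\<in>UNIV. w $ i * (\<Sum>j\<in>UNIV. A i j * (g (x $ i - x $ j) - g (y $ i - y $ j))))"
    by (simp add: inner_vec_def network_flow_def right_diff_distrib sum_subtractf)
  also have "\<dots> = 1 / 2 *
     (\<Sum>i\<in>UNIV. \<Sum>j\<in>UNIV. A i j * (g (x $ i - x $ j) - g (y $ i - y $ j)) * (w $ i - w $ j))"
  proof (rule sum_antisymmetric_pairing)
    show "A i j * (g (x $ i - x $ j) - g (y $ i - y $ j)) =
        - (A j i * (g (x $ j - x $ i) - g (y $ j - y $ i)))" for i j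
      using sym[of i j] odd[of "x $ i - x $ j"] odd[of "y $ i - y $ j"] by (simp add: algebra_simps)
  qed
  finally show ?thesis .
qed

text \<open>Paired with \<open>x - y\<close>, every summand is a product of corresponding increments
  of \<open>g\<close> and of its argument, so the sector bound applies line by line.\<close>

lemma flow_strongly_monotone: "m / 2 * energy (x - y) \<le> (x - y) \<bullet> (flow x - flow y)"
proof -
  have "m * energy (x - y) \<le> (\<Sum>i\<in>UNIV. \<Sum>j\<in>UNIV.
      A i j * (g (x $ i - x $ j) - g (y $ i - y $ j)) * ((x - y) $ i - (x - y) $ j))"
    unfolding dirichlet_form_def sum_distrib_left
  proof (intro sum_mono)
    fix i j
    have "A i j * (m * ((x $ i - x $ j) - (y $ i - y $ j))\<^sup>2) \<le>
        A i j * ((g (x $ i - x $ j) - g (y $ i - y $ j)) * ((x $ i - x $ j) - (y $ i - y $ j)))"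
      by (rule mult_left_mono[OF strongly_monotone nonneg])
    then show "m * (A i j * ((x - y) $ i - (x - y) $ j)\<^sup>2) \<le>
        A i j * (g (x $ i - x $ j) - g (y $ i - y $ j)) * ((x - y) $ i - (x - y) $ j)"
      by (simp add: algebra_simps)
  qed
  then show ?thesis by (simp add: flow_pairing)
qed

lemma sum_flow_diff: "(\<Sum>i\<in>UNIV. (flow x - flow y) $ i) = 0"
  using flow_pairing[of "\<chi> i. 1" x y] by (simp add: inner_vec_def)

lemma energy_nonneg: "energy w \<ge> 0"
  unfolding dirichlet_form_def by (intro sum_nonneg mult_nonneg_nonneg nonneg) auto

lemma energy_zero_imp_constant:
  assumes "energy w = 0"
  shows "w $ i = w $ j"
proof -
  have "A i j * (w $ i - w $ j)\<^sup>2 = 0" for i j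
    using assms unfolding dirichlet_form_def
    by (simp add: sum_nonneg_eq_0_iff sum_nonneg nonneg)
  then have "w $ a = w $ b" if "A a b > 0" for a b
    using that by (metis less_irrefl mult_eq_0_iff power2_eq_square right_minus_eq)
  with connected[of i j] show ?thesis by (induction rule: rtrancl_induct) auto
qed

lemma flow_lipschitz:
  obtains K where "K > 0" and "\<And>x y. norm (flow x - flow y) \<le> K * norm (x - y)"
\<comment> \<open>The factor 2 accounts for the two endpoints of a line; the summand 1 keeps the
  constant positive even if all couplings vanish.\<close>
proof (rule that[of "1 + (\<Sum>i\<in>UNIV. \<Sum>j\<in>UNIV. A i j * 2)"])
  show "1 + (\<Sum>i\<in>UNIV. \<Sum>j\<in>UNIV. A i j * 2) > 0"
    using nonneg by (intro add_pos_nonneg sum_nonneg) auto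
  fix x y :: "real ^ 'n"
  have "norm (flow x - flow y) \<le> (\<Sum>i\<in>UNIV. \<bar>(flow x - flow y) $ i\<bar>)" by (rule norm_le_l1_cart)
  also have "\<dots> \<le> (\<Sum>i\<in>UNIV. \<Sum>j\<in>UNIV. A i j * 2 * norm (x - y))"
  proof (rule sum_mono)
    fix i
    have "\<bar>(flow x - flow y) $ i\<bar> = \<bar>\<Sum>j\<in>UNIV. A i j * (g (x $ i - x $ j) - g (y $ i - y $ j))\<bar>"
      by (simp add: network_flow_def right_diff_distrib sum_subtractf)
    also have "\<dots> \<le> (\<Sum>j\<in>UNIV. \<bar>A i j * (g (x $ i - x $ j) - g (y $ i - y $ j))\<bar>)" by (rule sum_abs)
    also have "\<dots> \<le> (\<Sum>j\<in>UNIV. A i j * 2 * norm (x - y))"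
    proof (rule sum_mono)
      fix j
      have "\<bar>g (x $ i - x $ j) - g (y $ i - y $ j)\<bar> \<le> \<bar>(x - y) $ i\<bar> + \<bar>(x - y) $ j\<bar>"
        using nonexpansive[of "x $ i - x $ j" "y $ i - y $ j"] by simp
      also have "\<dots> \<le> 2 * norm (x - y)"
        using component_le_norm_cart[of "x - y" i] component_le_norm_cart[of "x - y" j] by simp
      finally show "\<bar>A i j * (g (x $ i - x $ j) - g (y $ i - y $ j))\<bar> \<le> A i j * 2 * norm (x - y)"
        using mult_left_mono[OF _ nonneg[of i j]] nonneg[of i j] by (simp add: abs_mult mult.assoc)
    qed
    finally show "\<bar>(flow x - flow y) $ i\<bar> \<le> (\<Sum>j\<in>UNIV. A i j * 2 * norm (x - y))" .
  qed
  also have "\<dots> = (\<Sum>i\<in>UNIV. \<Sum>j\<in>UNIV. A i j * 2) * norm (x - y)"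
    by (simp add: sum_distrib_right)
  also have "\<dots> \<le> (1 + (\<Sum>i\<in>UNIV. \<Sum>j\<in>UNIV. A i j * 2)) * norm (x - y)"
    by (simp add: distrib_right)
  finally show "norm (flow x - flow y) \<le> (1 + (\<Sum>i\<in>UNIV. \<Sum>j\<in>UNIV. A i j * 2)) * norm (x - y)" .
qed

lemma continuous_on_energy [continuous_intros]:
  "continuous_on S f \<Longrightarrow> continuous_on S (\<lambda>x. energy (f x))"
  unfolding dirichlet_form_def by (intro continuous_intros)

lemma energy_scaleR: "energy (a *\<^sub>R w) = a\<^sup>2 * energy w"
  by (simp add: dirichlet_form_def sum_distrib_left power_mult_distrib mult_ac flip: right_diff_distrib)

text \<open>Only constant vectors have zero energy, and a constant that vanishes on a nonempty set
  of nodes is zero.\<close>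

lemma energy_coercive_pinned:
  assumes "I \<noteq> {}"
  obtains c where "c > 0" and "\<And>w. c * (norm w)\<^sup>2 \<le> energy w + (norm (restrict_vec I w))\<^sup>2"
proof (rule homogeneous_coercive[of "\<lambda>w. energy w + (norm (restrict_vec I w))\<^sup>2"])
  show "continuous_on UNIV (\<lambda>w. energy w + (norm (restrict_vec I w))\<^sup>2)"
    by (intro continuous_intros)
  show "energy (a *\<^sub>R w) + (norm (restrict_vec I (a *\<^sub>R w)))\<^sup>2 =
      a\<^sup>2 * (energy w + (norm (restrict_vec I w))\<^sup>2)" for a w
    by (simp add: energy_scaleR restrict_vec_scaleR power_mult_distrib distrib_left)
  show "0 < energy w + (norm (restrict_vec I w))\<^sup>2" if "w \<noteq> 0" for w
  proof (rule ccontr)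
    assume "\<not> ?thesis"
    with energy_nonneg[of w] have *: "energy w = 0" "(norm (restrict_vec I w))\<^sup>2 = 0"
      using zero_le_power2[of "norm (restrict_vec I w)"] by linarith+
    obtain i where "i \<in> I" using assms by blast
    with *(2) have "w $ i = 0" by (metis norm_eq_zero power_eq_0_iff restrict_vec_nth zero_index)
    with energy_zero_imp_constant[OF *(1), of _ i] that show False by (simp add: vec_eq_iff)
  qed
qed (use that in blast)

text \<open>Here the weighted sum over \<open>I\<close> excludes the constants, because the weights
  are positive. Its square completes the energy to a positive definite form, which is then
  restricted to the hyperplane where the sum vanishes.\<close>

lemma energy_coercive_centered:
  assumes "I \<noteq> {}" and D: "\<And>i. i \<in> I \<Longrightarrow> D i > 0"
  obtains c where "c > 0" and "\<And>w. (\<Sum>i\<in>I. D i * w $ i) = 0 \<Longrightarrow> c * (norm w)\<^sup>2 \<le> energy w"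
proof (rule homogeneous_coercive[of "\<lambda>w. energy w + (\<Sum>i\<in>I. D i * w $ i)\<^sup>2"])
  show "continuous_on UNIV (\<lambda>w. energy w + (\<Sum>i\<in>I. D i * w $ i)\<^sup>2)"
    by (intro continuous_intros)
  have "(\<Sum>i\<in>I. D i * (a *\<^sub>R w) $ i) = a * (\<Sum>i\<in>I. D i * w $ i)" for a and w :: "real ^ 'n"
    by (simp add: sum_distrib_left mult_ac)
  then show "energy (a *\<^sub>R w) + (\<Sum>i\<in>I. D i * (a *\<^sub>R w) $ i)\<^sup>2 =
      a\<^sup>2 * (energy w + (\<Sum>i\<in>I. D i * w $ i)\<^sup>2)" for a w
    by (simp only: energy_scaleR power_mult_distrib distrib_left)
  show "0 < energy w + (\<Sum>i\<in>I. D i * w $ i)\<^sup>2" if "w \<noteq> 0" for w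
  proof (rule ccontr)
    assume "\<not> ?thesis"
    with energy_nonneg[of w] have *: "energy w = 0" "(\<Sum>i\<in>I. D i * w $ i)\<^sup>2 = 0"
      using zero_le_power2[of "\<Sum>i\<in>I. D i * w $ i"] by linarith+
    obtain i where "i \<in> I" using assms by blast
    have const: "w $ j = w $ i" for j by (rule energy_zero_imp_constant[OF *(1)])
    have "(\<Sum>j\<in>I. D j) * w $ i = (\<Sum>j\<in>I. D j * w $ j)"
      unfolding sum_distrib_right by (intro sum.cong refl arg_cong[OF const[symmetric]])
    then have "(\<Sum>j\<in>I. D j) * w $ i = 0" using *(2) by simp
    moreover have "(\<Sum>i\<in>I. D i) > 0" using assms by (intro sum_pos) auto
    ultimately have "w $ i = 0" by simp
    with const that show False by (simp add: vec_eq_iff)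
  qed
next
  fix c assume c: "c > 0" "\<And>w. c * (norm w)\<^sup>2 \<le> energy w + (\<Sum>i\<in>I. D i * w $ i)\<^sup>2"
  show thesis
  proof (rule that[OF c(1)])
    show "c * (norm w)\<^sup>2 \<le> energy w" if "(\<Sum>i\<in>I. D i * w $ i) = 0" for w
      using c(2)[of w] that by simp
  qed
qed

end

section \<open>Load equations and inverter dynamics for a sector coupling\<close>

locale droop_network = sector_network A g m
  for A :: "'n::finite \<Rightarrow> 'n \<Rightarrow> real" and g m +
  fixes I :: "'n set" and D p :: "'n \<Rightarrow> real"
  assumes I_nonempty: "I \<noteq> {}" and D_pos: "i \<in> I \<Longrightarrow> D i > 0"
begin

definition load_consistent :: "real ^ 'n \<Rightarrow> bool" where
  "load_consistent x \<longleftrightarrow> (\<forall>i. i \<notin> I \<longrightarrow> flow x $ i = p i)"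

text \<open>Counterpart of \<open>dae_solution\<close> with \<open>flow\<close> instead of the
  physical injections; the two notions are exchanged wherever both coupling functions agree.\<close>

definition droop_solution :: "real set \<Rightarrow> (real \<Rightarrow> real ^ 'n) \<Rightarrow> bool" where
  "droop_solution J x \<longleftrightarrow> continuous_on J x \<and> (\<forall>t\<in>J. load_consistent (x t)) \<and>
     (\<forall>t\<in>J. \<forall>i\<in>I. \<exists>v. ((\<lambda>s. x s $ i) has_real_derivative v) (at t within J) \<and>
        D i * v = p i - flow (x t) $ i)"

lemma droop_solution_subset:
  assumes "droop_solution J x" and "J' \<subseteq> J"
  shows "droop_solution J' x"
  using assms unfolding droop_solution_def
  by (meson continuous_on_subset DERIV_subset subset_eq)

text \<open>The flow difference vanishes at the loads, so monotonicity bounds the energy of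
  \<open>x - y\<close> by the inverter part times the full norm. Pinned coercivity then allows one
  factor of the full norm to be divided out. This yields uniqueness and Lipschitz dependence of the
  load angles.\<close>

lemma load_consistent_diff_le:
  obtains C where "C > 0" and "\<And>x y. load_consistent x \<Longrightarrow> load_consistent y \<Longrightarrow>
    norm (x - y) \<le> C * norm (restrict_vec I (x - y))"
proof -
  obtain c where c: "c > 0" "\<And>w. c * (norm w)\<^sup>2 \<le> energy w + (norm (restrict_vec I w))\<^sup>2"
    using energy_coercive_pinned[OF I_nonempty] by blast
  obtain K where K: "K > 0" "\<And>x y. norm (flow x - flow y) \<le> K * norm (x - y)"
    using flow_lipschitz by blast
  show ?thesis
  proof (rule that[of "(2 / m * K + 1) / c"])
    show "(2 / m * K + 1) / c > 0" using c(1) K(1) m_pos by (auto intro!: divide_pos_pos add_pos_pos)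
    fix x y assume "load_consistent x" "load_consistent y"
    then have "restrict_vec I (flow x - flow y) = flow x - flow y"
      unfolding load_consistent_def by (auto simp: vec_eq_iff)
    then have "(x - y) \<bullet> (flow x - flow y) = restrict_vec I (x - y) \<bullet> (flow x - flow y)"
      by (metis inner_restrict_vec)
    also have "\<dots> \<le> norm (restrict_vec I (x - y)) * norm (flow x - flow y)"
      by (rule norm_cauchy_schwarz)
    also have "\<dots> \<le> norm (restrict_vec I (x - y)) * (K * norm (x - y))"
      by (intro mult_left_mono K) auto
    finally have "m / 2 * energy (x - y) \<le> norm (restrict_vec I (x - y)) * (K * norm (x - y))"
      using flow_strongly_monotone[of x y] by linarith
    then have "energy (x - y) \<le> 2 / m * K * norm (restrict_vec I (x - y)) * norm (x - y)"
      using m_pos by (simp add: field_simps)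
    moreover have "(norm (restrict_vec I (x - y)))\<^sup>2 \<le> norm (restrict_vec I (x - y)) * norm (x - y)"
      unfolding power2_eq_square by (intro mult_left_mono norm_restrict_vec_le) auto
    ultimately have "c * norm (x - y) * norm (x - y) \<le>
        (2 / m * K + 1) * norm (restrict_vec I (x - y)) * norm (x - y)"
      using c(2)[of "x - y"] by (simp add: power2_eq_square algebra_simps)
    then have "c * norm (x - y) \<le> (2 / m * K + 1) * norm (restrict_vec I (x - y))"
      using c(1) K(1) m_pos by (cases "norm (x - y) = 0") (auto intro!: mult_nonneg_nonneg add_nonneg_nonneg)
    then show "norm (x - y) \<le> (2 / m * K + 1) / c * norm (restrict_vec I (x - y))"
      using c(1) by (simp add: field_simps)
  qed
qed

text \<open>With the inverter angles frozen, a damped step against the load residual is a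
  contraction, since the flow is strongly monotone on differences that vanish on
  \<open>I\<close>.\<close>

lemma load_angles_exist:
  obtains x where "load_consistent x" and "\<And>i. i \<in> I \<Longrightarrow> x $ i = y $ i"
proof -
  obtain c where c: "c > 0" "\<And>w. c * (norm w)\<^sup>2 \<le> energy w + (norm (restrict_vec I w))\<^sup>2"
    using energy_coercive_pinned[OF I_nonempty] by blast
  obtain K0 where K0: "K0 > 0" "\<And>x y. norm (flow x - flow y) \<le> K0 * norm (x - y)"
    using flow_lipschitz by blast
  define \<mu> where "\<mu> = m * c / 2"
  \<comment> \<open>Enlarging the Lipschitz constant guarantees \<open>\<mu> < K\<close>, so that
    \<open>q\<close> is a genuine square root strictly between 0 and 1.\<close>
  define K where "K = K0 + \<mu>"
  have \<mu>: "\<mu> > 0" using c(1) m_pos by (simp add: \<mu>_def)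
  then have K: "K > \<mu>" "K > 0" using K0(1) by (auto simp: K_def)
  \<comment> \<open>This step size minimises
    \<open>1 - 2 * \<tau> * \<mu> + \<tau>\<^sup>2 * K\<^sup>2\<close>; the minimum is the square of
    the contraction factor \<open>q\<close>.\<close>
  define \<tau> where "\<tau> = \<mu> / K\<^sup>2"
  define X where "X z = restrict_vec I y + restrict_vec (- I) z" for z
  define T where "T z = restrict_vec (- I) (z - \<tau> *\<^sub>R (flow (X z) - (\<chi> i. p i)))" for z
  define q where "q = sqrt (1 - \<mu>\<^sup>2 / K\<^sup>2)"
  have ratio: "0 < \<mu>\<^sup>2 / K\<^sup>2" "\<mu>\<^sup>2 / K\<^sup>2 < 1"
    using \<mu> K by (auto intro!: power_strict_mono)
  have contraction: "norm (T z - T z') \<le> q * norm (z - z')" for z z'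
  proof -
    define w where "w = restrict_vec (- I) (z - z')"
    define h where "h = flow (X z) - flow (X z')"
    have w: "X z - X z' = w" by (simp add: X_def w_def restrict_vec_diff)
    have [simp]: "restrict_vec I w = 0" by (simp add: vec_eq_iff w_def)
    have "\<mu> * (norm w)\<^sup>2 \<le> m / 2 * energy w"
      using c(2)[of w] m_pos by (simp add: \<mu>_def field_simps)
    also have "\<dots> \<le> w \<bullet> h" using flow_strongly_monotone[of "X z" "X z'"] by (simp add: w h_def)
    also have "\<dots> = w \<bullet> restrict_vec (- I) h"
      unfolding w_def by (simp add: inner_restrict_vec) (auto simp: vec_eq_iff intro!: arg_cong[of _ _ "inner (z - z')"])
    finally have wh: "\<mu> * (norm w)\<^sup>2 \<le> w \<bullet> restrict_vec (- I) h" .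
    have "norm (restrict_vec (- I) h) \<le> K * norm w"
    proof -
      have "norm (restrict_vec (- I) h) \<le> norm h" by (rule norm_restrict_vec_le)
      also have "\<dots> \<le> K0 * norm w" using K0(2)[of "X z" "X z'"] by (simp add: w h_def)
      also have "\<dots> \<le> K * norm w" using \<mu> by (intro mult_right_mono) (auto simp: K_def)
      finally show ?thesis .
    qed
    then have hh: "(norm (restrict_vec (- I) h))\<^sup>2 \<le> K\<^sup>2 * (norm w)\<^sup>2"
      by (metis norm_ge_zero power_mono power_mult_distrib)
    have expand: "(norm (u - \<tau> *\<^sub>R v))\<^sup>2 = (norm u)\<^sup>2 - 2 * \<tau> * (u \<bullet> v) + \<tau>\<^sup>2 * (norm v)\<^sup>2"
      for u v :: "real ^ 'n"
      unfolding power2_norm_eq_inner inner_diff_left inner_diff_right inner_scaleR_left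
        inner_scaleR_right inner_commute[of v u]
      by (simp only: power2_eq_square) (simp only: algebra_simps)
    have "T z - T z' = w - \<tau> *\<^sub>R restrict_vec (- I) h"
      by (simp add: T_def w_def h_def vec_eq_iff algebra_simps)
    then have "(norm (T z - T z'))\<^sup>2 = (norm (w - \<tau> *\<^sub>R restrict_vec (- I) h))\<^sup>2"
      by (simp only:)
    also have "\<dots> = (norm w)\<^sup>2 - 2 * \<tau> * (w \<bullet> restrict_vec (- I) h) + \<tau>\<^sup>2 * (norm (restrict_vec (- I) h))\<^sup>2"
      by (rule expand)
    also have "\<dots> \<le> (norm w)\<^sup>2 - 2 * \<tau> * (\<mu> * (norm w)\<^sup>2) + \<tau>\<^sup>2 * (K\<^sup>2 * (norm w)\<^sup>2)"
      using wh hh \<mu> K by (intro add_mono diff_mono mult_left_mono) (auto simp: \<tau>_def)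
    also have "\<dots> = (1 - \<mu>\<^sup>2 / K\<^sup>2) * (norm w)\<^sup>2"
      using K by (simp add: \<tau>_def field_simps power2_eq_square)
    also have "\<dots> = (q * norm w)\<^sup>2"
      using ratio by (simp add: q_def power_mult_distrib)
    finally have "(norm (T z - T z'))\<^sup>2 \<le> (q * norm w)\<^sup>2" .
    then have "norm (T z - T z') \<le> q * norm w"
      by (rule power2_le_imp_le) (use ratio in \<open>auto simp: q_def\<close>)
    also have "\<dots> \<le> q * norm (z - z')"
      using ratio unfolding w_def by (intro mult_left_mono norm_restrict_vec_le) (auto simp: q_def)
    finally show ?thesis .
  qed
  have "\<exists>!z. T z = z"
    using contraction ratio by (intro banach_fix_type[of q]) (auto simp: q_def dist_norm)
  then obtain z where z: "T z = z" by blast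
  show ?thesis
  proof (rule that[of "X z"])
    have "flow (X z) $ i = p i" if "i \<notin> I" for i
    proof -
      have "T z $ i = z $ i - \<tau> * (flow (X z) $ i - p i)" using that by (simp add: T_def)
      then have "\<tau> * (flow (X z) $ i - p i) = 0" using z by simp
      then show ?thesis using \<mu> K by (simp add: \<tau>_def)
    qed
    then show "load_consistent (X z)" by (simp add: load_consistent_def)
  qed (simp add: X_def)
qed

lemma droop_solution_exists:
  assumes x0: "load_consistent x0"
  obtains x where "x 0 = x0" and "droop_solution {0..} x"
proof -
  obtain C where C: "C > 0" "\<And>x y. load_consistent x \<Longrightarrow> load_consistent y \<Longrightarrow>
    norm (x - y) \<le> C * norm (restrict_vec I (x - y))" using load_consistent_diff_le by blast
  obtain K where K: "K > 0" "\<And>x y. norm (flow x - flow y) \<le> K * norm (x - y)"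
    using flow_lipschitz by blast
  have "\<exists>x. load_consistent x \<and> (\<forall>i\<in>I. x $ i = y $ i)" for y
    by (rule load_angles_exist[of y]) auto
  then obtain H where H: "\<And>y. load_consistent (H y)" "\<And>y i. i \<in> I \<Longrightarrow> H y $ i = y $ i"
    using choice[of "\<lambda>y x. load_consistent x \<and> (\<forall>i\<in>I. x $ i = y $ i)"] by blast
  have H_lip: "norm (H y - H y') \<le> C * norm (y - y')" for y y'
  proof -
    have "restrict_vec I (H y - H y') = restrict_vec I (y - y')" using H(2) by (simp add: vec_eq_iff)
    with C(2)[OF H(1) H(1), of y y'] have "norm (H y - H y') \<le> C * norm (restrict_vec I (y - y'))"
      by simp
    also have "\<dots> \<le> C * norm (y - y')" using C(1) by (intro mult_left_mono norm_restrict_vec_le) auto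
    finally show ?thesis .
  qed
  \<comment> \<open>The equation is posed on the full space with zero right-hand side at the loads:
    those components of \<open>y\<close> are inert, and the actual load angles are read off from
    \<open>H y\<close>.\<close>
  define F where "F y = (\<chi> i. of_bool (i \<in> I) * ((p i - flow (H y) $ i) / D i))" for y
  have F_lip: "norm (F y - F y') \<le> ((\<Sum>i\<in>I. 1 / D i) * (K * C)) * norm (y - y')" for y y'
  proof -
    have flow_le: "\<bar>(flow (H y) - flow (H y')) $ i\<bar> \<le> K * C * norm (y - y')" for i
    proof -
      have "\<bar>(flow (H y) - flow (H y')) $ i\<bar> \<le> norm (flow (H y) - flow (H y'))"
        by (rule component_le_norm_cart)
      also have "\<dots> \<le> K * norm (H y - H y')" by (rule K(2))
      also have "\<dots> \<le> K * (C * norm (y - y'))" using K(1) H_lip by (intro mult_left_mono) auto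
      finally show ?thesis by (simp add: mult.assoc)
    qed
    have "norm (F y - F y') \<le> (\<Sum>i\<in>UNIV. \<bar>(F y - F y') $ i\<bar>)" by (rule norm_le_l1_cart)
    also have "\<dots> = (\<Sum>i\<in>I. \<bar>(F y - F y') $ i\<bar>)"
      by (rule sum.mono_neutral_right) (auto simp: F_def)
    also have "\<dots> \<le> (\<Sum>i\<in>I. 1 / D i * (K * C * norm (y - y')))"
    proof (rule sum_mono)
      fix i assume i: "i \<in> I"
      then have "(F y - F y') $ i = - (1 / D i * (flow (H y) - flow (H y')) $ i)"
        by (simp add: F_def diff_divide_distrib)
      then have "\<bar>(F y - F y') $ i\<bar> = 1 / D i * \<bar>(flow (H y) - flow (H y')) $ i\<bar>"
        using D_pos[OF i] by (simp add: abs_mult)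
      also have "\<dots> \<le> 1 / D i * (K * C * norm (y - y'))"
        using D_pos[OF i] flow_le by (intro mult_left_mono) auto
      finally show "\<bar>(F y - F y') $ i\<bar> \<le> 1 / D i * (K * C * norm (y - y'))" .
    qed
    also have "\<dots> = ((\<Sum>i\<in>I. 1 / D i) * (K * C)) * norm (y - y')"
      by (simp only: sum_distrib_right mult.assoc)
    finally show ?thesis .
  qed
  from lipschitz_ode_global_solution[OF F_lip, of x0] obtain y where y: "y 0 = x0"
    "\<And>t. 0 \<le> t \<Longrightarrow> (y has_vector_derivative F (y t)) (at t within {0..})" by blast
  show ?thesis
  proof (rule that[of "\<lambda>t. H (y t)"])
    \<comment> \<open>Inverter angles determine consistent load angles uniquely, so \<open>H\<close>
      returns the consistent initial state unchanged.\<close>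
    have "restrict_vec I (H x0 - x0) = 0" using H(2) by (simp add: vec_eq_iff)
    with C(2)[OF H(1) x0, of x0] show "H (y 0) = x0" by (simp add: y(1))
    have cont_y: "continuous_on {0..} y"
      using y(2) by (intro continuous_on_vector_derivative[of "{0..}" y "\<lambda>t. F (y t)"]) auto
    have "continuous_on UNIV H"
      using C(1) H_lip by (intro lipschitz_onI[THEN lipschitz_on_continuous_on]) (auto simp: dist_norm)
    from continuous_on_compose2[OF this cont_y] have cont: "continuous_on {0..} (\<lambda>t. H (y t))"
      by simp
    have deriv: "((\<lambda>s. H (y s) $ i) has_real_derivative F (y t) $ i) (at t within {0..})"
      if "0 \<le> t" "i \<in> I" for t i
      unfolding has_real_derivative_iff_has_vector_derivative H(2)[OF that(2)]
      by (rule bounded_linear.has_vector_derivative[OF bounded_linear_vec_nth y(2)[OF that(1)]])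
    have rhs: "D i * F (y t) $ i = p i - flow (H (y t)) $ i" if "i \<in> I" for t i
      using that D_pos[OF that] by (simp add: F_def)
    show "droop_solution {0..} (\<lambda>t. H (y t))"
      unfolding droop_solution_def
    proof (intro conjI ballI)
      fix t i assume "t \<in> {0::real..}" "i \<in> I"
      then show "\<exists>v. ((\<lambda>s. H (y s) $ i) has_real_derivative v) (at t within {0..}) \<and>
          D i * v = p i - flow (H (y t)) $ i"
        using deriv[of t i] rhs[of i t] by auto
    qed (use cont H(1) in auto)
  qed
qed

text \<open>The constants are chosen before \<open>xs\<close>, \<open>b\<close> and
  \<open>x\<close>, so a single pair serves all rotated equilibria and all times. The vanishing
  weighted sum removes the rotation mode, on which nothing decays.\<close>

lemma droop_solution_decay:
  obtains C \<mu> where "C > 0" and "\<mu> > 0"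
    and "\<And>xs b x. \<lbrakk>\<And>i. flow xs $ i = p i; 0 \<le> b; droop_solution {0..b} x;
      (\<Sum>i\<in>I. D i * (x 0 - xs) $ i) = 0\<rbrakk> \<Longrightarrow>
      norm (x b - xs) \<le> C * exp (- \<mu> * b) * norm (x 0 - xs)"
proof -
  obtain C where C: "C > 0" "\<And>x y. load_consistent x \<Longrightarrow> load_consistent y \<Longrightarrow>
    norm (x - y) \<le> C * norm (restrict_vec I (x - y))" using load_consistent_diff_le by blast
  obtain c where c: "c > 0" "\<And>w. (\<Sum>i\<in>I. D i * w $ i) = 0 \<Longrightarrow> c * (norm w)\<^sup>2 \<le> energy w"
    using energy_coercive_centered[of I D, OF I_nonempty D_pos] by blast
  define d where "d = (\<Sum>i\<in>I. D i)"
  define d0 where "d0 = Min (D ` I)"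
  have d: "d > 0" unfolding d_def using I_nonempty D_pos by (intro sum_pos) auto
  have d0: "d0 > 0" "\<And>i. i \<in> I \<Longrightarrow> d0 \<le> D i"
    unfolding d0_def using I_nonempty D_pos by auto
  define W where "W w = (\<Sum>i\<in>I. D i * (w $ i)\<^sup>2)" for w :: "real ^ 'n"
  have W_le: "W w \<le> d * (norm w)\<^sup>2" for w
    unfolding W_def d_def sum_distrib_right
  proof (intro sum_mono mult_left_mono)
    show "(w $ i)\<^sup>2 \<le> (norm w)\<^sup>2" for i
      using component_le_norm_cart[of w i] by (intro abs_le_square_iff[THEN iffD1]) simp
    show "0 \<le> D i" if "i \<in> I" for i using D_pos[OF that] by simp
  qed
  have W_ge: "d0 * (norm (restrict_vec I w))\<^sup>2 \<le> W w" for w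
  proof -
    have "(norm (restrict_vec I w))\<^sup>2 = (\<Sum>i\<in>UNIV. (restrict_vec I w $ i)\<^sup>2)"
      by (simp add: norm_vec_def L2_set_def sum_nonneg)
    also have "\<dots> = (\<Sum>i\<in>I. (w $ i)\<^sup>2)"
      by (rule sum.mono_neutral_cong_right) auto
    finally show ?thesis
      unfolding W_def using d0(2) by (auto simp: sum_distrib_left intro!: sum_mono mult_right_mono)
  qed
  \<comment> \<open>The rate combines \<open>W w \<le> d * (norm w)\<^sup>2\<close>, centered
    coercivity with \<open>c\<close>, and the bound of the pairing by \<open>m / 2 * energy\<close>;
    together they make the derivative of \<open>W\<close> at most
    \<open>- \<nu> * W\<close>.\<close>
  define \<nu> where "\<nu> = m * c / d"
  have \<nu>: "\<nu> > 0" using m_pos c(1) d by (simp add: \<nu>_def)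
  show ?thesis
  proof (rule that[of "C * sqrt (d / d0)" "\<nu> / 2"])
    show "C * sqrt (d / d0) > 0" "\<nu> / 2 > 0" using C(1) d d0(1) \<nu> by auto
    fix xs b x
    assume eq: "\<And>i. flow xs $ i = p i" and b: "0 \<le> b" and sol: "droop_solution {0..b} x"
      and centered: "(\<Sum>i\<in>I. D i * (x 0 - xs) $ i) = 0"
    define w where "w t = x t - xs" for t
    have contw: "continuous_on {0..b} w"
      using sol unfolding w_def[abs_def] droop_solution_def by (intro continuous_on_diff continuous_on_const) blast
    have cons: "load_consistent (x t)" if "t \<in> {0..b}" for t
      using sol that unfolding droop_solution_def by blast
    \<comment> \<open>Two-sided derivatives are available only at interior times; at the endpoints
      the monotonicity arguments below rely on continuity.\<close>
    have deriv: "((\<lambda>s. w s $ i) has_real_derivative (flow xs - flow (x t)) $ i / D i) (at t)"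
      if "0 < t" "t < b" "i \<in> I" for t i
    proof -
      have "t \<in> {0..b}" using that by simp
      with sol that(3) obtain v where v: "((\<lambda>s. x s $ i) has_real_derivative v) (at t within {0..b})"
        "D i * v = p i - flow (x t) $ i"
        unfolding droop_solution_def by blast
      have "at t within {0..b} = at t" using that by (intro at_within_interior) simp
      with DERIV_diff[OF v(1) DERIV_const[of "xs $ i"]]
      have "((\<lambda>s. w s $ i) has_real_derivative v) (at t)" by (simp add: w_def)
      moreover have "v = (flow xs - flow (x t)) $ i / D i"
        using v(2) D_pos[OF that(3)] eq by (simp add: field_simps)
      ultimately show ?thesis by simp
    qed
    have load0: "(flow xs - flow (x t)) $ i = 0" if "t \<in> {0..b}" "i \<notin> I" for t i
      using cons[OF that(1)] that(2) eq by (simp add: load_consistent_def)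
    have centered_t: "(\<Sum>i\<in>I. D i * w t $ i) = 0" if "t \<in> {0..b}" for t
    proof (cases "t = 0")
      case False
      have "(\<Sum>i\<in>I. D i * w t $ i) = (\<Sum>i\<in>I. D i * w 0 $ i)"
      proof (rule DERIV_isconst_end[of 0 t "\<lambda>t. \<Sum>i\<in>I. D i * w t $ i"])
        show "0 < t" using that False by auto
        show "continuous_on {0..t} (\<lambda>t. \<Sum>i\<in>I. D i * w t $ i)"
          using that by (intro continuous_intros continuous_on_subset[OF contw]) auto
        fix s assume s: "0 < s" "s < t"
        have "((\<lambda>t. \<Sum>i\<in>I. D i * w t $ i) has_real_derivative
            (\<Sum>i\<in>I. D i * ((flow xs - flow (x s)) $ i / D i))) (at s)"
          using s that by (intro DERIV_sum DERIV_cmult deriv) auto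
        moreover have "(\<Sum>i\<in>I. D i * ((flow xs - flow (x s)) $ i / D i)) =
            (\<Sum>i\<in>I. (flow xs - flow (x s)) $ i)"
          by (intro sum.cong) (auto dest!: D_pos)
        \<comment> \<open>The weights \<open>D i\<close> have cancelled and the loads contribute 0,
          so the sum is the total flow difference, which vanishes.\<close>
        moreover have "\<dots> = (\<Sum>i\<in>UNIV. (flow xs - flow (x s)) $ i)"
          using s that by (intro sum.mono_neutral_left) (auto simp del: vector_minus_component intro!: load0)
        ultimately show "((\<lambda>t. \<Sum>i\<in>I. D i * w t $ i) has_real_derivative 0) (at s)"
          by (simp only: sum_flow_diff)
      qed
      then show ?thesis using centered by (simp add: w_def)
    qed (use centered in \<open>simp add: w_def\<close>)
    have "exp (\<nu> * b) * W (w b) \<le> exp (\<nu> * 0) * W (w 0)"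
    proof (rule DERIV_nonpos_imp_decreasing_open[OF b])
      show "continuous_on {0..b} (\<lambda>t. exp (\<nu> * t) * W (w t))"
        unfolding W_def by (intro continuous_intros contw)
      fix t assume t: "0 < t" "t < b"
      have "((\<lambda>t. W (w t)) has_real_derivative
          (\<Sum>i\<in>I. D i * (2 * w t $ i * ((flow xs - flow (x t)) $ i / D i)))) (at t)"
        unfolding W_def
      proof (rule DERIV_sum)
        fix i assume "i \<in> I"
        then show "((\<lambda>t. D i * (w t $ i)\<^sup>2) has_real_derivative
            D i * (2 * w t $ i * ((flow xs - flow (x t)) $ i / D i))) (at t)"
          by (rule DERIV_cong[OF DERIV_cmult[OF DERIV_power[OF deriv[OF t]]]]) simp
      qed
      moreover have "(\<Sum>i\<in>I. D i * (2 * w t $ i * ((flow xs - flow (x t)) $ i / D i))) =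
          (\<Sum>i\<in>I. 2 * w t $ i * (flow xs - flow (x t)) $ i)"
        by (intro sum.cong) (auto dest!: D_pos)
      moreover have "\<dots> = (\<Sum>i\<in>UNIV. 2 * w t $ i * (flow xs - flow (x t)) $ i)"
        using t load0[of t] by (intro sum.mono_neutral_left) (auto simp del: vector_minus_component)
      moreover have "\<dots> = - 2 * ((x t - xs) \<bullet> (flow (x t) - flow xs))"
        by (simp add: inner_vec_def w_def sum_distrib_left right_diff_distrib flip: sum_negf)
          (simp add: algebra_simps)
      ultimately have W': "((\<lambda>t. W (w t)) has_real_derivative
          - 2 * ((x t - xs) \<bullet> (flow (x t) - flow xs))) (at t)" by simp
      have "\<nu> * W (w t) \<le> \<nu> * (d * (norm (w t))\<^sup>2)" using \<nu> by (intro mult_left_mono W_le) auto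
      also have "\<dots> = m * (c * (norm (w t))\<^sup>2)" using d by (simp add: \<nu>_def)
      also have "\<dots> \<le> m * energy (w t)"
        using t m_pos by (intro mult_left_mono c(2) centered_t) auto
      also have "\<dots> \<le> 2 * ((x t - xs) \<bullet> (flow (x t) - flow xs))"
        using flow_strongly_monotone[of "x t" xs] by (simp add: w_def)
      finally have "\<nu> * W (w t) - 2 * ((x t - xs) \<bullet> (flow (x t) - flow xs)) \<le> 0" by simp
      moreover have "((\<lambda>t. exp (\<nu> * t) * W (w t)) has_real_derivative
          exp (\<nu> * t) * (\<nu> * W (w t) - 2 * ((x t - xs) \<bullet> (flow (x t) - flow xs)))) (at t)"
        by (auto intro!: derivative_eq_intros W' simp: algebra_simps)
      ultimately show "\<exists>y. ((\<lambda>t. exp (\<nu> * t) * W (w t)) has_real_derivative y) (at t) \<and> y \<le> 0"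
        by (meson exp_ge_zero mult_nonneg_nonpos)
    qed
    then have Wb: "W (w b) \<le> exp (- \<nu> * b) * W (w 0)"
      by (simp add: exp_minus field_simps)
    \<comment> \<open>\<open>W\<close> controls the inverter angles only; load consistency passes
      the decay on to all angles at the cost of \<open>C\<close>, while \<open>d\<close> and
      \<open>d0\<close> compare \<open>W\<close> with the Euclidean norm.\<close>
    have "load_consistent xs" using eq by (simp add: load_consistent_def)
    with C(2) cons b have "norm (w b) \<le> C * norm (restrict_vec I (w b))" by (auto simp: w_def)
    then have "(norm (w b))\<^sup>2 \<le> C\<^sup>2 * (norm (restrict_vec I (w b)))\<^sup>2"
      by (metis norm_ge_zero power_mono power_mult_distrib)
    also have "\<dots> \<le> C\<^sup>2 * (W (w b) / d0)"
      using W_ge[of "w b"] d0(1) by (intro mult_left_mono) (auto simp: field_simps)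
    also have "\<dots> \<le> C\<^sup>2 * (exp (- \<nu> * b) * (d * (norm (w 0))\<^sup>2) / d0)"
    proof -
      have "exp (- \<nu> * b) * W (w 0) \<le> exp (- \<nu> * b) * (d * (norm (w 0))\<^sup>2)"
        by (intro mult_left_mono W_le) auto
      with Wb have "W (w b) \<le> exp (- \<nu> * b) * (d * (norm (w 0))\<^sup>2)" by linarith
      then show ?thesis using d0(1) by (intro mult_left_mono divide_right_mono) auto
    qed
    also have "exp (- \<nu> * b) = (exp (- (\<nu> / 2) * b))\<^sup>2" by (simp flip: exp_double)
    also have "C\<^sup>2 * ((exp (- (\<nu> / 2) * b))\<^sup>2 * (d * (norm (w 0))\<^sup>2) / d0) =
        (C * sqrt (d / d0) * exp (- (\<nu> / 2) * b) * norm (w 0))\<^sup>2"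
      using d d0(1) by (simp add: power_mult_distrib)
    finally have "(norm (w b))\<^sup>2 \<le> (C * sqrt (d / d0) * exp (- (\<nu> / 2) * b) * norm (w 0))\<^sup>2" .
    then have "norm (w b) \<le> C * sqrt (d / d0) * exp (- (\<nu> / 2) * b) * norm (w 0)"
      by (rule power2_le_imp_le) (use C(1) d d0(1) in auto)
    then show "norm (x b - xs) \<le> C * sqrt (d / d0) * exp (- (\<nu> / 2) * b) * norm (x 0 - xs)"
      by (simp add: w_def)
  qed
qed

end

subsection \<open>Microgrids\<close>

lemma acyclic_microgridD:
  assumes "acyclic_microgrid N"
  shows "loads N \<union> inverters N = UNIV" "loads N \<inter> inverters N = {}" "inverters N \<noteq> {}"
    "\<And>e. e \<in> lines N \<Longrightarrow> card e = 2" "graph_connected (lines N)" "graph_acyclic (lines N)"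
    "\<And>i j. admittance N i j = admittance N j i"
    "\<And>i j. {i, j} \<in> lines N \<Longrightarrow> Im (admittance N i j) > 0"
    "\<And>i j. i \<noteq> j \<Longrightarrow> {i, j} \<notin> lines N \<Longrightarrow> admittance N i j = 0"
    "\<And>i. voltage N i > 0"
  using assms unfolding acyclic_microgrid_def by simp_all

text \<open>Diagonal admittances are unconstrained and might be negative, so the diagonal is set to
  0; since \<open>sin 0 = 0\<close>, the injections are unaffected.\<close>

definition coupling :: "'n::finite microgrid \<Rightarrow> 'n \<Rightarrow> 'n \<Rightarrow> real" where
  "coupling N i j = (if i = j then 0 else Im (admittance N i j) * voltage N i * voltage N j)"

lemma power_injection_eq_flow: "power_injection N \<theta> i = network_flow (coupling N) sin \<theta> $ i"
  unfolding power_injection_def network_flow_def coupling_def by (auto intro!: sum.cong)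

lemma coupling_sym: "acyclic_microgrid N \<Longrightarrow> coupling N i j = coupling N j i"
  using acyclic_microgridD(7)[of N i j] by (simp add: coupling_def)

lemma coupling_pos_iff:
  assumes "acyclic_microgrid N"
  shows "coupling N i j > 0 \<longleftrightarrow> {i, j} \<in> lines N"
proof (cases "{i, j} \<in> lines N")
  case True
  then have "i \<noteq> j" using acyclic_microgridD(4)[OF assms, of "{i, j}"] by auto
  with True acyclic_microgridD(8,10)[OF assms] show ?thesis by (simp add: coupling_def)
next
  case False
  then show ?thesis using acyclic_microgridD(9)[OF assms, of i j] by (simp add: coupling_def)
qed

lemma coupling_eq_0:
  assumes "acyclic_microgrid N" and "{i, j} \<notin> lines N"
  shows "coupling N i j = 0"
  using acyclic_microgridD(9)[OF assms(1), of i j] assms(2) by (simp add: coupling_def)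

lemma coupling_nonneg: "acyclic_microgrid N \<Longrightarrow> coupling N i j \<ge> 0"
  using coupling_pos_iff[of N i j] coupling_eq_0[of N i j] by fastforce

text \<open>Lines are lossless: what enters at one end leaves at the other. Formally this is the
  pairing with the constant vector, whose differences vanish.\<close>

lemma sum_power_injection:
  assumes "acyclic_microgrid N"
  shows "(\<Sum>i\<in>UNIV. power_injection N \<theta> i) = 0"
proof -
  have "(\<Sum>i\<in>UNIV. 1 * (\<Sum>j\<in>UNIV. coupling N i j * sin (\<theta> $ i - \<theta> $ j))) =
      1 / 2 * (\<Sum>i\<in>UNIV. \<Sum>j\<in>UNIV. coupling N i j * sin (\<theta> $ i - \<theta> $ j) * (1 - 1))"
  proof (rule sum_antisymmetric_pairing)
    show "coupling N i j * sin (\<theta> $ i - \<theta> $ j) = - (coupling N j i * sin (\<theta> $ j - \<theta> $ i))" for i j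
      using coupling_sym[OF assms, of i j] sin_minus[of "\<theta> $ i - \<theta> $ j"] by simp
  qed
  then show ?thesis by (simp add: power_injection_eq_flow network_flow_def)
qed

text \<open>
  The sine, continued affinely beyond \<open>[- \<gamma>, \<gamma>]\<close>; in contrast to the sine it is globally strongly
  monotone.
\<close>

definition extended_sin :: "real \<Rightarrow> real \<Rightarrow> real" where
  "extended_sin \<gamma> d = sin (max (- \<gamma>) (min \<gamma> d)) + cos \<gamma> * (d - max (- \<gamma>) (min \<gamma> d))"

lemma extended_sin_eq:
  assumes "\<bar>d\<bar> \<le> \<gamma>"
  shows "extended_sin \<gamma> d = sin d"
proof -
  have "max (- \<gamma>) (min \<gamma> d) = d" using assms by linarith
  then show ?thesis by (simp add: extended_sin_def)
qed

lemma extended_sin_minus: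
  assumes "0 \<le> \<gamma>"
  shows "extended_sin \<gamma> (- d) = - extended_sin \<gamma> d"
proof -
  have "max (- \<gamma>) (min \<gamma> (- d)) = - max (- \<gamma>) (min \<gamma> d)" using assms by linarith
  then show ?thesis by (simp add: extended_sin_def algebra_simps)
qed

lemma sin_diff_bounds:
  fixes x y \<gamma> :: real
  assumes "- \<gamma> \<le> y" "y \<le> x" "x \<le> \<gamma>" "\<gamma> \<le> pi"
  shows "cos \<gamma> * (x - y) \<le> sin x - sin y" and "sin x - sin y \<le> x - y"
proof -
  have "cos \<gamma> * (x - y) \<le> sin x - sin y \<and> sin x - sin y \<le> x - y"
  proof (cases "y = x")
    case False
    with assms have "y < x" by simp
    from MVT2[OF this, of sin cos] obtain z where z: "y < z" "z < x" "sin x - sin y = (x - y) * cos z"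
      using DERIV_sin by blast
    have "cos \<gamma> \<le> cos \<bar>z\<bar>" using z assms by (intro cos_monotone_0_pi_le) auto
    then have "cos \<gamma> \<le> cos z" by simp
    with z(3) \<open>y < x\<close> show ?thesis
      using mult_left_mono[of "cos \<gamma>" "cos z" "x - y"] mult_left_mono[of "cos z" 1 "x - y"]
      by (simp add: mult.commute)
  qed simp
  then show "cos \<gamma> * (x - y) \<le> sin x - sin y" and "sin x - sin y \<le> x - y" by auto
qed

text \<open>Clamping splits \<open>a - b\<close> into a part inside
  \<open>[- \<gamma>, \<gamma>]\<close>, where the sine has slopes between
  \<open>cos \<gamma>\<close> and 1, and a remainder on which the slope is exactly
  \<open>cos \<gamma>\<close>.\<close>

lemma extended_sin_diff_bounds:
  assumes "0 \<le> \<gamma>" "\<gamma> < pi / 2" "b \<le> a"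
  shows "cos \<gamma> * (a - b) \<le> extended_sin \<gamma> a - extended_sin \<gamma> b"
    and "extended_sin \<gamma> a - extended_sin \<gamma> b \<le> a - b"
proof -
  define x y where "x = max (- \<gamma>) (min \<gamma> a)" and "y = max (- \<gamma>) (min \<gamma> b)"
  have xy: "- \<gamma> \<le> y" "y \<le> x" "x \<le> \<gamma>" "x - y \<le> a - b"
    using assms unfolding x_def y_def by linarith+
  have diff: "extended_sin \<gamma> a - extended_sin \<gamma> b = sin x - sin y + cos \<gamma> * ((a - b) - (x - y))"
    by (simp add: extended_sin_def x_def y_def algebra_simps)
  have sin: "cos \<gamma> * (x - y) \<le> sin x - sin y" "sin x - sin y \<le> x - y"
    using sin_diff_bounds[of \<gamma> y x] xy assms by auto
  have "cos \<gamma> * (a - b) = cos \<gamma> * (x - y) + cos \<gamma> * ((a - b) - (x - y))" by (simp add: algebra_simps)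
  with sin(1) diff show "cos \<gamma> * (a - b) \<le> extended_sin \<gamma> a - extended_sin \<gamma> b" by linarith
  have "cos \<gamma> * ((a - b) - (x - y)) \<le> (a - b) - (x - y)"
    using xy(4) mult_right_mono[OF cos_le_one[of \<gamma>], of "(a - b) - (x - y)"] by simp
  with sin(2) diff show "extended_sin \<gamma> a - extended_sin \<gamma> b \<le> a - b" by linarith
qed

lemma microgrid_sector_network:
  assumes N: "acyclic_microgrid N" and \<gamma>: "0 \<le> \<gamma>" "\<gamma> < pi / 2"
  shows "sector_network (coupling N) (extended_sin \<gamma>) (cos \<gamma>)"
proof
  show "coupling N i j = coupling N j i" for i j by (rule coupling_sym[OF N])
  show "coupling N i j \<ge> 0" for i j by (rule coupling_nonneg[OF N])
  show "(i, j) \<in> {(a, b). coupling N a b > 0}\<^sup>*" for i j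
    using acyclic_microgridD(5)[OF N] by (simp add: coupling_pos_iff[OF N] graph_connected_def)
  show "extended_sin \<gamma> (- a) = - extended_sin \<gamma> a" for a by (rule extended_sin_minus[OF \<gamma>(1)])
  show c: "cos \<gamma> > 0" using \<gamma> by (intro cos_gt_zero_pi) auto
  show "cos \<gamma> * (a - b)\<^sup>2 \<le> (extended_sin \<gamma> a - extended_sin \<gamma> b) * (a - b)" for a b
  proof (cases "b \<le> a")
    case True
    then show ?thesis
      using mult_right_mono[OF extended_sin_diff_bounds(1)[OF \<gamma> True], of "a - b"]
      by (simp add: power2_eq_square mult.assoc)
  next
    case False
    then have "a \<le> b" by simp
    then show ?thesis
      using mult_right_mono[OF extended_sin_diff_bounds(1)[OF \<gamma> \<open>a \<le> b\<close>], of "b - a"]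
      by (simp add: power2_eq_square algebra_simps)
  qed
  have mono: "0 \<le> extended_sin \<gamma> a - extended_sin \<gamma> b" if "b \<le> a" for a b
    using extended_sin_diff_bounds(1)[OF \<gamma> that] c that
    by (meson diff_ge_0_iff_ge less_imp_le mult_nonneg_nonneg order_trans)
  show "\<bar>extended_sin \<gamma> a - extended_sin \<gamma> b\<bar> \<le> \<bar>a - b\<bar>" for a b
    using extended_sin_diff_bounds(2)[OF \<gamma>, of a b] extended_sin_diff_bounds(2)[OF \<gamma>, of b a]
      mono[of a b] mono[of b a] by linarith
qed

lemma extended_flow_eq_power_injection:
  assumes N: "acyclic_microgrid N"
    and "\<And>i j. {i, j} \<in> lines N \<Longrightarrow> \<bar>\<theta> $ i - \<theta> $ j\<bar> \<le> \<gamma>"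
  shows "network_flow (coupling N) (extended_sin \<gamma>) \<theta> $ i = power_injection N \<theta> i"
proof -
  have "coupling N i j * extended_sin \<gamma> (\<theta> $ i - \<theta> $ j) = coupling N i j * sin (\<theta> $ i - \<theta> $ j)" for j
  proof (cases "{i, j} \<in> lines N")
    case True
    then show ?thesis using extended_sin_eq[OF assms(2)[OF True]] by simp
  next
    case False
    then show ?thesis using coupling_eq_0[OF N False] by simp
  qed
  then show ?thesis by (simp only: power_injection_eq_flow network_flow_def vec_lambda_beta)
qed

lemma cohesive_lift:
  assumes N: "acyclic_microgrid N" and "\<gamma> \<le> pi" and "\<theta> \<in> cohesive_set N \<gamma>"
  obtains \<phi> where "\<phi> \<in> rot_orbit \<theta>" and "\<And>i j. {i, j} \<in> lines N \<Longrightarrow> \<bar>\<phi> $ i - \<phi> $ j\<bar> < \<gamma>"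
proof (rule forest_lift[of "lines N" "\<lambda>e. \<gamma>" \<theta>])
  show "circle_dist (\<theta> $ i) (\<theta> $ j) < \<gamma>" if "{i, j} \<in> lines N" for i j
    using assms(3) that unfolding cohesive_set_def by blast
qed (use assms that acyclic_microgridD[OF N] in auto)

text \<open>After lifting, the extended flows coincide with the injections, so strong monotonicity
  makes the energy of the difference vanish; a constant difference is a rotation.\<close>

lemma cohesive_flow_unique:
  fixes N :: "'n::finite microgrid"
  assumes N: "acyclic_microgrid N" and \<gamma>: "0 \<le> \<gamma>" "\<gamma> < pi / 2"
    and "\<theta> \<in> cohesive_set N \<gamma>" "\<phi> \<in> cohesive_set N \<gamma>"
    and eq: "power_injection N \<theta> = power_injection N \<phi>"
  shows "rot_orbit \<theta> = rot_orbit \<phi>"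
proof -
  interpret sector_network "coupling N" "extended_sin \<gamma>" "cos \<gamma>"
    by (rule microgrid_sector_network[OF N \<gamma>])
  have "\<gamma> \<le> pi" using \<gamma> by simp
  obtain \<theta>' where \<theta>': "\<theta>' \<in> rot_orbit \<theta>" "\<And>i j. {i, j} \<in> lines N \<Longrightarrow> \<bar>\<theta>' $ i - \<theta>' $ j\<bar> < \<gamma>"
    using cohesive_lift[OF N \<open>\<gamma> \<le> pi\<close> assms(4)] by blast
  obtain \<phi>' where \<phi>': "\<phi>' \<in> rot_orbit \<phi>" "\<And>i j. {i, j} \<in> lines N \<Longrightarrow> \<bar>\<phi>' $ i - \<phi>' $ j\<bar> < \<gamma>"
    using cohesive_lift[OF N \<open>\<gamma> \<le> pi\<close> assms(5)] by blast
  have "flow \<theta>' $ i = power_injection N \<theta> i" for i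
    using extended_flow_eq_power_injection[OF N, of \<theta>' \<gamma> i] \<theta>'(2) power_injection_rotate[OF \<theta>'(1)]
    by (simp add: less_imp_le)
  moreover have "flow \<phi>' $ i = power_injection N \<phi> i" for i
    using extended_flow_eq_power_injection[OF N, of \<phi>' \<gamma> i] \<phi>'(2) power_injection_rotate[OF \<phi>'(1)]
    by (simp add: less_imp_le)
  ultimately have "flow \<theta>' - flow \<phi>' = 0" using eq by (simp add: vec_eq_iff)
  with flow_strongly_monotone[of \<theta>' \<phi>'] have "cos \<gamma> * energy (\<theta>' - \<phi>') \<le> 0" by simp
  with m_pos energy_nonneg[of "\<theta>' - \<phi>'"] have "energy (\<theta>' - \<phi>') = 0"
    by (simp add: mult_le_0_iff)
  from energy_zero_imp_constant[OF this] have const: "\<theta>' $ i - \<phi>' $ i = \<theta>' $ j - \<phi>' $ j" for i j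
    by (simp flip: vector_minus_component)
  fix i0 :: 'n
  have "\<theta>' \<in> rot_orbit \<phi>'"
    unfolding rot_orbit_def using const[of _ i0]
    by (auto simp: algebra_simps intro!: exI[of _ "\<theta>' $ i0 - \<phi>' $ i0"] exI[of _ "\<lambda>i. 0"])
  with \<theta>'(1) \<phi>'(1) show ?thesis by (metis rot_orbit_eq)
qed

section \<open>Equilibrium manifolds and their local exponential stability\<close>

lemma equilibrium_iff:
  assumes "acyclic_microgrid N"
  shows "equilibrium N D \<theta> \<longleftrightarrow> (\<forall>i. power_injection N \<theta> i = shifted_injection N D i)"
proof -
  have stationary: "(\<exists>v. ((\<lambda>s::real. c) has_real_derivative v) (at t) \<and> d * v = x) \<longleftrightarrow> x = 0"
    for c d x t :: real
  proof -
    have "v = 0" if "((\<lambda>s::real. c) has_real_derivative v) (at t)" for v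
      using that by (rule DERIV_unique) (rule DERIV_const)
    then show ?thesis using DERIV_const[of c "at t"] by fastforce
  qed
  have split: "(\<forall>i. P i) \<longleftrightarrow> (\<forall>i\<in>loads N. P i) \<and> (\<forall>i\<in>inverters N. P i)" for P
    using acyclic_microgridD(1)[OF assms] by blast
  show ?thesis
    unfolding equilibrium_def dae_solution_def consistent_state_def stationary
      split[of "\<lambda>i. power_injection N \<theta> i = shifted_injection N D i"]
    by auto
qed

lemma equilibrium_manifold_rot_orbit:
  assumes "acyclic_microgrid N"
  shows "equilibrium_manifold N D (rot_orbit \<theta>) \<longleftrightarrow>
    (\<forall>i. power_injection N \<theta> i = shifted_injection N D i)"
proof
  assume "equilibrium_manifold N D (rot_orbit \<theta>)"
  then show "\<forall>i. power_injection N \<theta> i = shifted_injection N D i"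
    unfolding equilibrium_manifold_def equilibrium_iff[OF assms] using rot_orbit_refl by blast
next
  assume "\<forall>i. power_injection N \<theta> i = shifted_injection N D i"
  then have "equilibrium N D \<phi>" if "\<phi> \<in> rot_orbit \<theta>" for \<phi>
    using power_injection_rotate[OF that, of N] by (simp add: equilibrium_iff[OF assms])
  then show "equilibrium_manifold N D (rot_orbit \<theta>)"
    unfolding equilibrium_manifold_def by blast
qed

text \<open>Carries solutions near an arbitrary point of the orbit to the chosen lift of the
  equilibrium and back.\<close>

lemma dae_solution_translate:
  assumes sol: "dae_solution N D J x" and inv: "\<And>y. power_injection N (y + c) = power_injection N y"
  shows "dae_solution N D J (\<lambda>t. x t + c)"
  unfolding dae_solution_def
proof (intro conjI ballI)
  show "continuous_on J (\<lambda>t. x t + c)"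
    using sol unfolding dae_solution_def by (intro continuous_on_add continuous_on_const) blast
  show "consistent_state N D (x t + c)" if "t \<in> J" for t
    using sol that unfolding dae_solution_def consistent_state_def inv by blast
  fix t i assume "t \<in> J" "i \<in> inverters N"
  with sol obtain v where v: "((\<lambda>s. x s $ i) has_real_derivative v) (at t within J)"
    "D i * v = shifted_injection N D i - power_injection N (x t) i"
    unfolding dae_solution_def by blast
  from DERIV_add[OF v(1) DERIV_const[of "c $ i"]] v(2)
  show "\<exists>v. ((\<lambda>s. (x s + c) $ i) has_real_derivative v) (at t within J) \<and>
      D i * v = shifted_injection N D i - power_injection N (x t + c) i"
    by (auto simp: inv)
qed

text \<open>Bootstrap argument: at the first time the value \<open>r\<close> is reached, the weak
  bound holds on the whole past, and the step then gives a strict bound, a contradiction.\<close>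

lemma continuous_stays_below:
  fixes f :: "real \<Rightarrow> real"
  assumes cont: "continuous_on {0..b} f" and "0 \<le> b" and "f 0 < r"
    and step: "\<And>t. \<lbrakk>0 \<le> t; t \<le> b; \<And>s. \<lbrakk>0 \<le> s; s \<le> t\<rbrakk> \<Longrightarrow> f s \<le> r\<rbrakk> \<Longrightarrow> f t < r"
  shows "f b < r"
proof (rule ccontr)
  assume "\<not> f b < r"
  define S where "S = {0..b} \<inter> f -` {r..}"
  have "closed S"
    unfolding S_def by (rule continuous_closed_preimage[OF cont closed_atLeastAtMost closed_atLeast])
  moreover have "bounded S"
    by (rule bounded_subset[OF bounded_closed_interval[of 0 b]]) (simp add: S_def)
  ultimately have "compact S" by (simp add: compact_eq_bounded_closed)
  moreover have "S \<noteq> {}" using \<open>\<not> f b < r\<close> \<open>0 \<le> b\<close> by (auto simp: S_def)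
  ultimately obtain \<tau> where \<tau>: "\<tau> \<in> S" "\<And>s. s \<in> S \<Longrightarrow> \<tau> \<le> s"
    using compact_attains_inf[of S] by blast
  have "0 \<le> \<tau>" "\<tau> \<le> b" "r \<le> f \<tau>" using \<tau>(1) by (auto simp: S_def)
  have below: "f s < r" if "0 \<le> s" "s < \<tau>" for s
  proof (rule ccontr)
    assume "\<not> f s < r"
    with that \<open>\<tau> \<le> b\<close> have "s \<in> S" by (simp add: S_def)
    with \<tau>(2)[of s] that show False by simp
  qed
  have "continuous_on {0..\<tau>} f"
    by (rule continuous_on_subset[OF cont]) (use \<open>\<tau> \<le> b\<close> in auto)
  then obtain \<sigma> where \<sigma>: "0 \<le> \<sigma>" "\<sigma> \<le> \<tau>" "f \<sigma> = r"
    using IVT'[of f 0 r \<tau>] \<open>f 0 < r\<close> \<open>0 \<le> \<tau>\<close> \<open>r \<le> f \<tau>\<close> by auto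
  then have "\<sigma> = \<tau>" using below[of \<sigma>] by linarith
  have "f s \<le> r" if "0 \<le> s" "s \<le> \<tau>" for s
    using below[of s] that \<sigma>(3) \<open>\<sigma> = \<tau>\<close> by (cases "s = \<tau>") auto
  from step[OF \<open>0 \<le> \<tau>\<close> \<open>\<tau> \<le> b\<close> this] \<sigma>(3) \<open>\<sigma> = \<tau>\<close> show False by simp
qed

text \<open>Since \<open>infdist x M\<close> is below \<open>\<delta>\<close>, the infimum is
  approached by points of \<open>M\<close> closer than \<open>\<delta>\<close>, so an estimate
  against those points passes to it.\<close>

lemma le_infdist_multI:
  assumes "M \<noteq> {}" and "infdist x M < \<delta>" and "0 < k"
    and le: "\<And>y. \<lbrakk>y \<in> M; dist x y < \<delta>\<rbrakk> \<Longrightarrow> a \<le> k * dist x y"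
  shows "a \<le> k * infdist x M"
proof (rule ccontr)
  assume "\<not> ?thesis"
  then have "infdist x M < a / k" using assms(3) by (simp add: pos_less_divide_eq mult.commute)
  with assms(2) have "Inf (dist x ` M) < min \<delta> (a / k)" by (simp add: infdist_notempty[OF assms(1)])
  then obtain y where y: "y \<in> M" "dist x y < min \<delta> (a / k)"
    using cInf_lessD[of "dist x ` M"] assms(1) by blast
  with le[of y] have "a \<le> k * dist x y" by simp
  moreover have "k * dist x y < a" using y(2) assms(3) by (simp add: pos_less_divide_eq mult.commute)
  ultimately show False by simp
qed

lemma cohesive_equilibrium_stable:
  fixes N :: "'n::finite microgrid"
  assumes N: "acyclic_microgrid N" and \<gamma>: "0 \<le> \<gamma>" "\<gamma> < pi / 2"
    and D: "\<And>i. i \<in> inverters N \<Longrightarrow> D i > 0"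
    and cohesive: "\<theta> \<in> cohesive_set N \<gamma>"
    and equilibrium: "\<And>i. power_injection N \<theta> i = shifted_injection N D i"
  shows "locally_exponentially_stable N D (rot_orbit \<theta>)"
proof -
  have "\<gamma> \<le> pi" using \<gamma> by simp
  from cohesive_lift[OF N this cohesive]
  obtain xs where xs: "xs \<in> rot_orbit \<theta>" "\<And>i j. {i, j} \<in> lines N \<Longrightarrow> \<bar>xs $ i - xs $ j\<bar> < \<gamma>"
    by blast
  define M where "M = rot_orbit \<theta>"
  have M: "M = rot_orbit xs" using rot_orbit_eq[OF xs(1)] by (simp add: M_def)
  define p where "p = shifted_injection N D"
  define I where "I = inverters N"
  \<comment> \<open>Room for perturbation: moving both ends of a line by at most \<open>r\<close>
    keeps the difference within \<open>\<gamma>'\<close>, where the extended and the true sine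
    agree, and \<open>\<gamma>'\<close> is still below \<open>pi / 2\<close>.\<close>
  define \<gamma>' where "\<gamma>' = (\<gamma> + pi / 2) / 2"
  define r where "r = (\<gamma>' - \<gamma>) / 2"
  have \<gamma>': "0 \<le> \<gamma>'" "\<gamma>' < pi / 2" using \<gamma> by (auto simp: \<gamma>'_def)
  have r: "r > 0" "\<gamma> + 2 * r = \<gamma>'" using \<gamma> by (simp_all add: r_def \<gamma>'_def field_simps)
  interpret sector_network "coupling N" "extended_sin \<gamma>'" "cos \<gamma>'"
    by (rule microgrid_sector_network[OF N \<gamma>'])
  interpret droop_network "coupling N" "extended_sin \<gamma>'" "cos \<gamma>'" I D p
    by unfold_locales (use acyclic_microgridD(3)[OF N] D in \<open>auto simp: I_def\<close>)
  have not_I: "i \<notin> I \<longleftrightarrow> i \<in> loads N" for i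
    using acyclic_microgridD(1,2)[OF N] unfolding I_def by blast
  define shift where "shift s = (\<chi> i. s) + xs" for s :: real
  have flow_near: "flow x $ i = power_injection N x i" if "norm (x - shift s) \<le> r" for x s i
  proof (rule extended_flow_eq_power_injection[OF N])
    fix i j assume "{i, j} \<in> lines N"
    moreover have "\<bar>(x - shift s) $ i\<bar> \<le> r" "\<bar>(x - shift s) $ j\<bar> \<le> r"
      using that component_le_norm_cart[of "x - shift s"] order_trans by blast+
    ultimately show "\<bar>x $ i - x $ j\<bar> \<le> \<gamma>'"
      using xs(2)[of i j] r(2) by (simp add: shift_def)
  qed
  have shift_M: "shift s \<in> M" for s
    unfolding M rot_orbit_def shift_def by (auto intro!: exI[of _ s] exI[of _ "\<lambda>i. 0"])
  have flow_shift: "flow (shift s) $ i = p i" for s i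
    using flow_near[of "shift s" s i] r(1) equilibrium power_injection_rotate[of "shift s" \<theta> N]
      shift_M[of s] by (simp add: M_def p_def)
  have solution_iff: "dae_solution N D J x \<longleftrightarrow> droop_solution J x"
    if "\<And>t. t \<in> J \<Longrightarrow> norm (x t - shift s) \<le> r" for J x s
  proof -
    have "flow (x t) $ i = power_injection N (x t) i" if "t \<in> J" for t i
      using flow_near \<open>\<And>t. t \<in> J \<Longrightarrow> norm (x t - shift s) \<le> r\<close>[OF that] by blast
    then show ?thesis
      unfolding dae_solution_def droop_solution_def consistent_state_def load_consistent_def not_I
        p_def[symmetric] I_def[symmetric] by auto
  qed
  obtain C0 \<mu> where C0: "C0 > 0" "\<mu> > 0"
    and decay: "\<And>xs b x. \<lbrakk>\<And>i. flow xs $ i = p i; 0 \<le> b; droop_solution {0..b} x;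
      (\<Sum>i\<in>I. D i * (x 0 - xs) $ i) = 0\<rbrakk> \<Longrightarrow>
      norm (x b - xs) \<le> C0 * exp (- \<mu> * b) * norm (x 0 - xs)"
    using droop_solution_decay by blast
  \<comment> \<open>At least 1, so that \<open>C * norm v < r\<close> implies
    \<open>norm v < r\<close>, as the initial state requires.\<close>
  define C where "C = max 1 C0"
  have C: "C \<ge> 1" "C0 \<le> C" by (auto simp: C_def)
  have decay': "norm (x b - shift s) \<le> C * exp (- \<mu> * b) * norm (x 0 - shift s)"
    "norm (x b - shift s) \<le> C * norm (x 0 - shift s)"
    if "0 \<le> b" "droop_solution {0..b} x" "(\<Sum>i\<in>I. D i * (x 0 - shift s) $ i) = 0" for b x s
  proof -
    have "norm (x b - shift s) \<le> C0 * exp (- \<mu> * b) * norm (x 0 - shift s)"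
      using flow_shift that by (rule decay)
    also have "\<dots> \<le> C * exp (- \<mu> * b) * norm (x 0 - shift s)"
      using C by (intro mult_right_mono) auto
    finally show le: "norm (x b - shift s) \<le> C * exp (- \<mu> * b) * norm (x 0 - shift s)" .
    also have "\<dots> \<le> C * 1 * norm (x 0 - shift s)"
      using C C0 that(1) by (intro mult_right_mono mult_left_mono) auto
    finally show "norm (x b - shift s) \<le> C * norm (x 0 - shift s)" by simp
  qed
  define d where "d = (\<Sum>i\<in>I. D i)"
  have d: "d > 0" unfolding d_def using I_nonempty D_pos by (intro sum_pos) auto
  define ones :: "real ^ 'n" where "ones = (\<chi> i. 1)"
  define \<kappa> where "\<kappa> = 1 + norm ones"
  have \<kappa>: "\<kappa> > 0" unfolding \<kappa>_def by (intro add_pos_nonneg) auto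
  \<comment> \<open>Centring may enlarge the distance by \<open>\<kappa>\<close> and the transient
    by \<open>C\<close>; with this \<open>\<delta>\<close> the deviation nevertheless stays below
    \<open>r\<close>.\<close>
  define \<delta> where "\<delta> = r / (C * \<kappa>)"
  have \<delta>: "\<delta> > 0" using r C \<kappa> by (simp add: \<delta>_def)
  have centre: "\<exists>s. (\<Sum>i\<in>I. D i * (y - shift s) $ i) = 0 \<and> norm (y - shift s) \<le> \<kappa> * norm (y - xs)" for y
  proof -
    \<comment> \<open>The weighted mean of the deviation. Its modulus is at most
      \<open>norm (y - xs)\<close>, which is where \<open>\<kappa> = 1 + norm ones\<close> comes
      from.\<close>
    define s where "s = (\<Sum>i\<in>I. D i * (y - xs) $ i) / d"
    have "(\<Sum>i\<in>I. D i * (y - shift s) $ i) = (\<Sum>i\<in>I. D i * (y - xs) $ i) - (\<Sum>i\<in>I. D i) * s"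
      unfolding sum_distrib_right by (simp add: shift_def algebra_simps sum.distrib sum_subtractf)
    also have "\<dots> = 0" using d by (simp add: s_def flip: d_def)
    finally have centred: "(\<Sum>i\<in>I. D i * (y - shift s) $ i) = 0" .
    have "\<bar>\<Sum>i\<in>I. D i * (y - xs) $ i\<bar> \<le> (\<Sum>i\<in>I. \<bar>D i * (y - xs) $ i\<bar>)" by (rule sum_abs)
    also have "\<dots> \<le> (\<Sum>i\<in>I. D i * norm (y - xs))"
    proof (rule sum_mono)
      fix i assume "i \<in> I"
      then have "\<bar>D i * (y - xs) $ i\<bar> = D i * \<bar>(y - xs) $ i\<bar>" using D_pos[of i] by (simp add: abs_mult)
      also have "\<dots> \<le> D i * norm (y - xs)"
        using D_pos[OF \<open>i \<in> I\<close>] by (intro mult_left_mono component_le_norm_cart) simp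
      finally show "\<bar>D i * (y - xs) $ i\<bar> \<le> D i * norm (y - xs)" .
    qed
    also have "\<dots> = d * norm (y - xs)" by (simp add: d_def sum_distrib_right)
    finally have s_le: "\<bar>s\<bar> \<le> norm (y - xs)" using d by (simp add: s_def field_simps)
    have shifted: "y - shift s = (y - xs) - s *\<^sub>R ones" by (simp add: shift_def ones_def vec_eq_iff)
    have "norm (y - shift s) \<le> norm (y - xs) + \<bar>s\<bar> * norm ones"
      unfolding shifted using norm_triangle_ineq4[of "y - xs" "s *\<^sub>R ones"] by simp
    also have "\<dots> \<le> norm (y - xs) + norm (y - xs) * norm ones"
      using s_le by (intro add_left_mono mult_right_mono) auto
    also have "\<dots> = \<kappa> * norm (y - xs)" by (simp add: \<kappa>_def algebra_simps)
    finally show ?thesis using centred by blast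
  qed
  have near: "\<exists>s c. (\<forall>y. y + c \<in> rot_orbit y \<and> y - c \<in> rot_orbit y) \<and> shift s + c \<in> M \<and>
      (\<Sum>i\<in>I. D i * (x0 - c - shift s) $ i) = 0 \<and>
      norm (x0 - c - shift s) \<le> \<kappa> * dist x0 m \<and> C * norm (x0 - c - shift s) < r"
    if "m \<in> M" "dist x0 m < \<delta>" for x0 m
  proof -
    \<comment> \<open>Translation by \<open>c\<close> takes the lift \<open>xs\<close> to the given
      point \<open>m\<close> of the orbit. It is a rotation plus full turns, hence leaves all
      injections unchanged and reduces everything to a neighbourhood of \<open>xs\<close>.\<close>
    define c where "c = m - xs"
    obtain s' k where "\<And>i. m $ i = xs $ i + s' + 2 * pi * of_int (k i)"
      using rot_orbitE[of m xs] \<open>m \<in> M\<close> M by metis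
    then have c: "c $ i = s' + 2 * pi * of_int (k i)" for i by (simp add: c_def)
    have rot: "y + c \<in> rot_orbit y" for y
      unfolding rot_orbit_def by (auto simp: c intro!: exI[of _ s'] exI[of _ k])
    have rot': "y - c \<in> rot_orbit y" for y
      unfolding rot_orbit_def by (auto simp: c intro!: exI[of _ "- s'"] exI[of _ "\<lambda>i. - k i"])
    obtain s where s: "(\<Sum>i\<in>I. D i * (x0 - c - shift s) $ i) = 0"
      "norm (x0 - c - shift s) \<le> \<kappa> * norm (x0 - c - xs)"
      using centre[of "x0 - c"] by blast
    have centre_eq: "x0 - c - xs = x0 - m" by (simp add: c_def)
    have s2: "norm (x0 - c - shift s) \<le> \<kappa> * dist x0 m" using s(2) unfolding centre_eq dist_norm .
    also have "\<dots> < \<kappa> * \<delta>" using that \<kappa> by (intro mult_strict_left_mono) auto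
    finally have "C * norm (x0 - c - shift s) < C * (\<kappa> * \<delta>)"
      using C by (intro mult_strict_left_mono) auto
    also have "C * (\<kappa> * \<delta>) = r" using C \<kappa> by (simp add: \<delta>_def)
    finally have "C * norm (x0 - c - shift s) < r" .
    moreover have "shift s + c \<in> M"
      using rot[of "shift s"] rot_orbit_eq[of "shift s" \<theta>] shift_M[of s] by (simp add: M_def)
    ultimately show ?thesis using rot rot' s(1) s2 by blast
  qed
  have small: "norm v < r" if "C * norm v < r" for v :: "real ^ 'n"
    using mult_right_mono[OF C(1), of "norm v"] that by simp
  have solvable: "\<exists>x. x 0 = x0 \<and> dae_solution N D {0..} x"
    if cons: "consistent_state N D x0" and near_M: "infdist x0 M < \<delta>" for x0
  proof -
    have "M \<noteq> {}" using shift_M by blast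
    with near_M obtain m where m: "m \<in> M" "dist x0 m < \<delta>"
      using cInf_lessD[of "dist x0 ` M" \<delta>] by (auto simp: infdist_notempty)
    obtain s c where sc: "\<And>y. y + c \<in> rot_orbit y" "\<And>y. y - c \<in> rot_orbit y"
      "(\<Sum>i\<in>I. D i * (x0 - c - shift s) $ i) = 0" "C * norm (x0 - c - shift s) < r"
      using near[OF m] by blast
    have "norm (x0 - c - shift s) \<le> r" using small[OF sc(4)] by simp
    from flow_near[OF this] have "flow (x0 - c) $ i = power_injection N x0 i" for i
      using power_injection_rotate[OF sc(2)] by simp
    then have "load_consistent (x0 - c)"
      using cons unfolding load_consistent_def consistent_state_def not_I p_def[symmetric] by simp
    then obtain x where x: "x 0 = x0 - c" "droop_solution {0..} x"
      by (rule droop_solution_exists)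
    have near_shift: "norm (x t - shift s) \<le> r" if "t \<in> {0..}" for t
    proof -
      have "0 \<le> t" using that by simp
      have "droop_solution {0..t} x" by (rule droop_solution_subset[OF x(2)]) auto
      from decay'(2)[OF \<open>0 \<le> t\<close> this, of s] sc(3)
      have "norm (x t - shift s) \<le> C * norm (x0 - c - shift s)" unfolding x(1) by blast
      with sc(4) show ?thesis by linarith
    qed
    have "dae_solution N D {0..} x" using solution_iff[of "{0..}" x s, OF near_shift] x(2) by blast
    then have "dae_solution N D {0..} (\<lambda>t. x t + c)"
      by (rule dae_solution_translate) (rule power_injection_rotate[OF sc(1)])
    with x(1) show ?thesis by (intro exI[of _ "\<lambda>t. x t + c"]) simp
  qed
  have estimate: "infdist (x t) M \<le> C * \<kappa> * exp (- \<mu> * t) * infdist x0 M"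
    if near_M: "infdist x0 M < \<delta>" and x0: "x 0 = x0" and sol: "dae_solution N D {0..<T} x"
      and t: "t \<in> {0..<T}" for x0 x T t
  proof (rule le_infdist_multI[OF _ near_M])
    show "M \<noteq> {}" using shift_M by blast
    show "0 < C * \<kappa> * exp (- \<mu> * t)" using C \<kappa> by (intro mult_pos_pos) auto
    fix m assume m: "m \<in> M" "dist x0 m < \<delta>"
    obtain s c where sc: "\<And>y. y + c \<in> rot_orbit y" "\<And>y. y - c \<in> rot_orbit y" "shift s + c \<in> M"
      "(\<Sum>i\<in>I. D i * (x0 - c - shift s) $ i) = 0" "norm (x0 - c - shift s) \<le> \<kappa> * dist x0 m"
      "C * norm (x0 - c - shift s) < r"
      using near[OF m] by blast
    define y where "y \<tau> = x \<tau> - c" for \<tau>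
    have "dae_solution N D {0..<T} (\<lambda>\<tau>. x \<tau> + - c)"
      by (rule dae_solution_translate[OF sol]) (use power_injection_rotate[OF sc(2)] in simp)
    then have y_sol: "dae_solution N D {0..<T} y" by (simp add: y_def[abs_def])
    have y0: "y 0 = x0 - c" by (simp add: y_def x0)
    have y_droop: "droop_solution {0..b} y"
      if b: "b < T" and bound: "\<And>\<tau>. 0 \<le> \<tau> \<Longrightarrow> \<tau> \<le> b \<Longrightarrow> norm (y \<tau> - shift s) \<le> r" for b
    proof -
      have "dae_solution N D {0..b} y"
      proof -
        have "{0..b} \<subseteq> {0..<T}" using b by auto
        with y_sol show ?thesis
          unfolding dae_solution_def by (meson continuous_on_subset DERIV_subset subset_eq)
      qed
      with solution_iff[of "{0..b}" y s] bound show ?thesis by simp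
    qed
    \<comment> \<open>The decay estimate applies to \<open>y\<close> only while \<open>y\<close>
      remains within \<open>r\<close> of the equilibrium; the bootstrap shows that it does so up to
      every time before \<open>T\<close>.\<close>
    have below: "norm (y b - shift s) < r" if b: "0 \<le> b" "b < T" for b
    proof (rule continuous_stays_below[of b "\<lambda>b. norm (y b - shift s)"])
      have "{0..b} \<subseteq> {0..<T}" using b by auto
      with y_sol have "continuous_on {0..b} y"
        unfolding dae_solution_def by (blast intro: continuous_on_subset)
      then show "continuous_on {0..b} (\<lambda>b. norm (y b - shift s))"
        by (intro continuous_on_norm continuous_on_diff continuous_on_const)
      show "norm (y 0 - shift s) < r" using small[OF sc(6)] by (simp add: y0)
      fix \<tau> assume \<tau>: "0 \<le> \<tau>" "\<tau> \<le> b"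
        and bound: "\<And>\<sigma>. 0 \<le> \<sigma> \<Longrightarrow> \<sigma> \<le> \<tau> \<Longrightarrow> norm (y \<sigma> - shift s) \<le> r"
      have "droop_solution {0..\<tau>} y" using \<tau>(2) b(2) by (intro y_droop bound) auto
      from decay'(2)[OF \<tau>(1) this, of s] sc(4,6) show "norm (y \<tau> - shift s) < r" by (simp add: y0)
    qed (use b in auto)
    have "0 \<le> t" "t < T" using t by auto
    have "droop_solution {0..t} y"
      by (rule y_droop[OF \<open>t < T\<close>], rule less_imp_le, rule below) (use \<open>t < T\<close> in auto)
    from decay'(1)[OF \<open>0 \<le> t\<close> this, of s] sc(4)
    have "norm (y t - shift s) \<le> C * exp (- \<mu> * t) * norm (x0 - c - shift s)" by (simp add: y0)
    also have "\<dots> \<le> C * exp (- \<mu> * t) * (\<kappa> * dist x0 m)"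
      using C by (intro mult_left_mono sc(5)) auto
    finally have "dist (x t) (shift s + c) \<le> C * exp (- \<mu> * t) * (\<kappa> * dist x0 m)"
      by (simp add: y_def dist_norm algebra_simps)
    then have "dist (x t) (shift s + c) \<le> C * \<kappa> * exp (- \<mu> * t) * dist x0 m" by (simp only: mult_ac)
    with infdist_le[OF sc(3), of "x t"] show "infdist (x t) M \<le> C * \<kappa> * exp (- \<mu> * t) * dist x0 m"
      by linarith
  qed
  have "C * \<kappa> > 0" using C \<kappa> by (intro mult_pos_pos) auto
  have "\<forall>x0. consistent_state N D x0 \<and> infdist x0 M < \<delta> \<longrightarrow>
      (\<exists>x. x 0 = x0 \<and> dae_solution N D {0..} x) \<and>
      (\<forall>T>0. \<forall>x. x 0 = x0 \<and> dae_solution N D {0..<T} x \<longrightarrow>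
        (\<forall>t\<in>{0..<T}. infdist (x t) M \<le> C * \<kappa> * exp (- \<mu> * t) * infdist x0 M))"
  proof (intro allI impI conjI ballI)
    fix x0 assume "consistent_state N D x0 \<and> infdist x0 M < \<delta>"
    then show "\<exists>x. x 0 = x0 \<and> dae_solution N D {0..} x" using solvable[of x0] by simp
    fix T x t assume "x 0 = x0 \<and> dae_solution N D {0..<T} x" "t \<in> {0..<T}"
    with \<open>consistent_state N D x0 \<and> infdist x0 M < \<delta>\<close>
    show "infdist (x t) M \<le> C * \<kappa> * exp (- \<mu> * t) * infdist x0 M" by (intro estimate) auto
  qed
  with \<delta> \<open>C * \<kappa> > 0\<close> C0(2) show ?thesis
    unfolding locally_exponentially_stable_def M_def[symmetric] by (intro exI conjI)
qed

section \<open>Marginal costs at a strictly feasible optimum\<close>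

lemma quadratic_nonneg_near_0:
  fixes B S :: real
  assumes "0 < \<epsilon>0" and "0 \<le> S"
    and nonneg: "\<And>\<epsilon>. \<bar>\<epsilon>\<bar> < \<epsilon>0 \<Longrightarrow> 0 \<le> \<epsilon> * B + \<epsilon>\<^sup>2 * S"
  shows "B = 0"
proof (rule ccontr)
  assume B: "B \<noteq> 0"
  \<comment> \<open>The test point will be \<open>- t * B\<close>: the first bound makes the linear
    term dominate the quadratic one, the second keeps the point within \<open>\<epsilon>0\<close>.
    The summand in \<open>S + 1\<close> covers \<open>S = 0\<close>.\<close>
  define t where "t = min (1 / (S + 1)) (\<epsilon>0 / (2 * \<bar>B\<bar>))"
  have t: "t > 0" "t \<le> 1 / (S + 1)" "t \<le> \<epsilon>0 / (2 * \<bar>B\<bar>)" using assms B by (auto simp: t_def)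
  have "t * S < 1"
  proof -
    have "t * (S + 1) \<le> 1" using t(2) assms(2) by (simp add: field_simps)
    then show ?thesis using t(1) by (simp add: distrib_left)
  qed
  have "\<bar>- t * B\<bar> = t * \<bar>B\<bar>" using t(1) by (simp add: abs_mult)
  also have "\<dots> \<le> \<epsilon>0 / 2" using t(3) B by (simp add: field_simps)
  also have "\<dots> < \<epsilon>0" using assms(1) by simp
  finally have "0 \<le> (- t * B) * B + (- t * B)\<^sup>2 * S" by (rule nonneg)
  also have "\<dots> = t * B\<^sup>2 * (t * S - 1)" by (simp add: power2_eq_square algebra_simps)
  finally have "0 \<le> t * B\<^sup>2 * (t * S - 1)" .
  moreover have "0 < t * B\<^sup>2" using t(1) B by simp
  ultimately have "0 \<le> t * S - 1" by (simp only: zero_le_mult_iff) linarith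
  with \<open>t * S < 1\<close> show False by simp
qed

text \<open>
  First-order optimality: an acyclic network can realise the transfer of a small amount of power from
  one inverter to another, by an arcsine of the perturbed line flows.
\<close>

lemma strict_optimal_dispatch_marginal_costs:
  fixes N :: "'n::finite microgrid"
  assumes N: "acyclic_microgrid N" and opt: "strict_optimal_dispatch N \<alpha> \<gamma> \<theta> u"
    and i: "i \<in> inverters N" and j: "j \<in> inverters N"
  shows "\<alpha> i * u i = \<alpha> j * u j"
proof -
  have \<alpha>: "\<And>k. k \<in> inverters N \<Longrightarrow> \<alpha> k > 0" and \<gamma>: "\<And>e. e \<in> lines N \<Longrightarrow> 0 \<le> \<gamma> e \<and> \<gamma> e < pi / 2"
    and balance: "power_balance N \<theta> u"
    and close: "\<And>a b. {a, b} \<in> lines N \<Longrightarrow> circle_dist (\<theta> $ a) (\<theta> $ b) < \<gamma> {a, b}"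
    and rating: "\<And>k. k \<in> inverters N \<Longrightarrow> 0 < power_injection N \<theta> k \<and> power_injection N \<theta> k < rating N k"
    and minimal: "\<And>\<theta>' u'. dispatch_feasible N \<gamma> \<theta>' u' \<Longrightarrow> dispatch_cost N \<alpha> u \<le> dispatch_cost N \<alpha> u'"
    using opt unfolding strict_optimal_dispatch_def dispatch_strictly_feasible_def
      dispatch_minimizer_def by simp_all
  have \<gamma>_pi: "\<gamma> e \<le> pi" if "e \<in> lines N" for e using \<gamma>[OF that] by simp
  obtain \<phi> where \<phi>: "\<phi> \<in> rot_orbit \<theta>" "\<And>a b. {a, b} \<in> lines N \<Longrightarrow> \<bar>\<phi> $ a - \<phi> $ b\<bar> < \<gamma> {a, b}"
    by (rule forest_lift[OF acyclic_microgridD(4,6,5)[OF N] \<gamma>_pi close]) blast+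
  obtain q :: "'n \<Rightarrow> 'n \<Rightarrow> real" where q: "\<And>a b. q a b = - q b a"
    "\<And>a b. {a, b} \<notin> lines N \<Longrightarrow> q a b = 0"
    "\<And>k. (\<Sum>b\<in>UNIV. q k b) = of_bool (k = i) - of_bool (k = j)"
    using graph_connected_unit_flow[OF acyclic_microgridD(5)[OF N], of i j] by metis
  define w :: "'n \<Rightarrow> real" where "w k = of_bool (k = i) - of_bool (k = j)" for k
  \<comment> \<open>The sine that a line difference must have in order to carry the old flow plus
    \<open>\<epsilon> * q a b\<close>; it is used only on lines, where the coupling is
    positive.\<close>
  define f where "f \<epsilon> a b = sin (\<phi> $ a - \<phi> $ b) + \<epsilon> * (q a b / coupling N a b)" for \<epsilon> a b
  \<comment> \<open>The constraints are finitely many and strict at \<open>\<epsilon> = 0\<close>,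
    so they survive all small perturbations of either sign.\<close>
  have "\<forall>\<^sub>F \<epsilon> in nhds 0. \<forall>a b. {a, b} \<in> lines N \<longrightarrow> \<bar>f \<epsilon> a b\<bar> < sin (\<gamma> {a, b})"
  proof (intro eventually_all_finite)
    fix a b
    show "\<forall>\<^sub>F \<epsilon> in nhds 0. {a, b} \<in> lines N \<longrightarrow> \<bar>f \<epsilon> a b\<bar> < sin (\<gamma> {a, b})"
    proof (cases "{a, b} \<in> lines N")
      case True
      have "\<bar>sin (\<phi> $ a - \<phi> $ b)\<bar> < sin (\<gamma> {a, b})"
      proof -
        have "sin (\<phi> $ a - \<phi> $ b) < sin (\<gamma> {a, b})" "sin (- (\<phi> $ a - \<phi> $ b)) < sin (\<gamma> {a, b})"
          using \<phi>(2)[OF True] \<gamma>[OF True] by (auto intro!: sin_monotone_2pi)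
        then show ?thesis by (simp add: abs_less_iff del: minus_diff_eq)
      qed
      moreover have "((\<lambda>\<epsilon>. \<bar>f \<epsilon> a b\<bar>) \<longlongrightarrow> \<bar>f 0 a b\<bar>) (nhds 0)"
        unfolding f_def by (intro tendsto_intros filterlim_ident)
      ultimately have "\<forall>\<^sub>F \<epsilon> in nhds 0. \<bar>f \<epsilon> a b\<bar> < sin (\<gamma> {a, b})"
        by (intro order_tendstoD(2)) (auto simp: f_def)
      then show ?thesis by (rule eventually_mono) simp
    qed simp
  qed
  moreover have "\<forall>\<^sub>F \<epsilon> in nhds 0. \<forall>k. k \<in> inverters N \<longrightarrow>
      0 < power_injection N \<theta> k + \<epsilon> * w k \<and> power_injection N \<theta> k + \<epsilon> * w k < rating N k"
  proof (intro eventually_all_finite)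
    fix k
    have lim: "((\<lambda>\<epsilon>. power_injection N \<theta> k + \<epsilon> * w k) \<longlongrightarrow> power_injection N \<theta> k + 0 * w k) (nhds 0)"
      by (intro tendsto_intros filterlim_ident)
    show "\<forall>\<^sub>F \<epsilon> in nhds 0. k \<in> inverters N \<longrightarrow>
      0 < power_injection N \<theta> k + \<epsilon> * w k \<and> power_injection N \<theta> k + \<epsilon> * w k < rating N k"
    proof (cases "k \<in> inverters N")
      case True
      then show ?thesis
        using order_tendstoD[OF lim] rating[OF True] by (auto intro: eventually_conj)
    qed simp
  qed
  ultimately have "\<forall>\<^sub>F \<epsilon> in nhds 0. (\<forall>a b. {a, b} \<in> lines N \<longrightarrow> \<bar>f \<epsilon> a b\<bar> < sin (\<gamma> {a, b})) \<and>
      (\<forall>k. k \<in> inverters N \<longrightarrow>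
        0 < power_injection N \<theta> k + \<epsilon> * w k \<and> power_injection N \<theta> k + \<epsilon> * w k < rating N k)"
    by (rule eventually_conj)
  then obtain \<epsilon>0 where "\<epsilon>0 > 0"
    and f_small: "\<And>\<epsilon> a b. \<bar>\<epsilon>\<bar> < \<epsilon>0 \<Longrightarrow> {a, b} \<in> lines N \<Longrightarrow> \<bar>f \<epsilon> a b\<bar> < sin (\<gamma> {a, b})"
    and w_small: "\<And>\<epsilon> k. \<bar>\<epsilon>\<bar> < \<epsilon>0 \<Longrightarrow> k \<in> inverters N \<Longrightarrow>
      0 < power_injection N \<theta> k + \<epsilon> * w k \<and> power_injection N \<theta> k + \<epsilon> * w k < rating N k"
    unfolding eventually_nhds_metric dist_real_def by (metis diff_zero)
  have cost_le: "0 \<le> \<epsilon> * (\<Sum>k\<in>inverters N. \<alpha> k * u k * w k) + \<epsilon>\<^sup>2 * (\<Sum>k\<in>inverters N. 1 / 2 * \<alpha> k * (w k)\<^sup>2)"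
    if \<epsilon>: "\<bar>\<epsilon>\<bar> < \<epsilon>0" for \<epsilon>
  proof -
    have f_anti: "arcsin (f \<epsilon> a b) = - arcsin (f \<epsilon> b a)" if "{a, b} \<in> lines N" for a b
    proof -
      have "f \<epsilon> a b = - f \<epsilon> b a"
        using q(1)[of a b] coupling_sym[OF N, of a b] sin_minus[of "\<phi> $ a - \<phi> $ b"] by (simp add: f_def)
      moreover have "{b, a} \<in> lines N" using that by (simp add: insert_commute)
      then have "\<bar>f \<epsilon> b a\<bar> \<le> 1"
        using f_small[OF \<epsilon>, of b a] sin_le_one[of "\<gamma> {b, a}"] by linarith
      then have "arcsin (- f \<epsilon> b a) = - arcsin (f \<epsilon> b a)" by (intro arcsin_minus) auto
      ultimately show ?thesis by simp
    qed
    obtain \<psi> where \<psi>: "\<And>a b. {a, b} \<in> lines N \<Longrightarrow> \<psi> a - \<psi> b = arcsin (f \<epsilon> a b)"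
      by (rule forest_potential[of "lines N" "\<lambda>a b. arcsin (f \<epsilon> a b)"])
        (use acyclic_microgridD(4,6)[OF N] f_anti in auto)
    define \<theta>' where "\<theta>' = (\<chi> k. \<psi> k)"
    have flow': "coupling N a b * sin (\<theta>' $ a - \<theta>' $ b) =
        coupling N a b * sin (\<phi> $ a - \<phi> $ b) + \<epsilon> * q a b" for a b
    proof (cases "{a, b} \<in> lines N")
      case True
      have "\<bar>f \<epsilon> a b\<bar> \<le> 1" using f_small[OF \<epsilon> True] sin_le_one[of "\<gamma> {a, b}"] by linarith
      then have "sin (\<theta>' $ a - \<theta>' $ b) = f \<epsilon> a b"
        by (simp add: \<theta>'_def \<psi>[OF True] abs_le_iff)
      moreover have "coupling N a b \<noteq> 0" using coupling_pos_iff[OF N, of a b] True by simp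
      ultimately show ?thesis by (simp add: f_def distrib_left)
    next
      case False
      then show ?thesis using coupling_eq_0[OF N False] q(2)[OF False] by simp
    qed
    have injection': "power_injection N \<theta>' k = power_injection N \<theta> k + \<epsilon> * w k" for k
    proof -
      have "power_injection N \<theta>' k = power_injection N \<phi> k + \<epsilon> * (\<Sum>b\<in>UNIV. q k b)"
        by (simp add: power_injection_eq_flow network_flow_def flow' sum.distrib sum_distrib_left)
      then show ?thesis using power_injection_rotate[OF \<phi>(1), of N] q(3)[of k] by (simp add: w_def)
    qed
    have "dispatch_feasible N \<gamma> \<theta>' (\<lambda>k. u k + \<epsilon> * w k)"
      unfolding dispatch_feasible_def
    proof (intro conjI allI impI)
      \<comment> \<open>Power is exchanged between the inverters \<open>i\<close> and
        \<open>j\<close> only, so every load keeps its injection.\<close>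
      have "w k = 0" if "k \<in> loads N" for k
        using that i j acyclic_microgridD(2)[OF N] by (auto simp: w_def)
      then show "power_balance N \<theta>' (\<lambda>k. u k + \<epsilon> * w k)"
        using balance by (auto simp: power_balance_def injection')
      show "\<forall>k\<in>inverters N. 0 \<le> power_injection N \<theta>' k \<and> power_injection N \<theta>' k \<le> rating N k"
        using w_small[OF \<epsilon>] by (auto simp: injection' intro: less_imp_le)
      fix a b assume ab: "{a, b} \<in> lines N"
      have g: "0 \<le> \<gamma> {a, b}" "\<gamma> {a, b} < pi / 2" using \<gamma>[OF ab] by auto
      have "\<bar>f \<epsilon> a b\<bar> \<le> 1" using f_small[OF \<epsilon> ab] sin_le_one[of "\<gamma> {a, b}"] by linarith
      then have s: "sin (arcsin (f \<epsilon> a b)) = f \<epsilon> a b" "- (pi / 2) \<le> arcsin (f \<epsilon> a b)" "arcsin (f \<epsilon> a b) \<le> pi / 2"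
        using arcsin_bounded[of "f \<epsilon> a b"] by (auto simp: abs_le_iff)
      \<comment> \<open>The sine is increasing on \<open>[- pi / 2, pi / 2]\<close>, which contains
        both the arcsine and \<open>\<gamma> {a, b}\<close>; the bound on sines thus becomes one on
        angles.\<close>
      have "arcsin (f \<epsilon> a b) \<le> \<gamma> {a, b}"
        using f_small[OF \<epsilon> ab] s g sin_mono_le_eq[of "arcsin (f \<epsilon> a b)" "\<gamma> {a, b}"] by auto
      moreover have "- \<gamma> {a, b} \<le> arcsin (f \<epsilon> a b)"
        using f_small[OF \<epsilon> ab] s g sin_mono_le_eq[of "- \<gamma> {a, b}" "arcsin (f \<epsilon> a b)"] by auto
      moreover have "circle_dist (\<theta>' $ a) (\<theta>' $ b) \<le> \<bar>arcsin (f \<epsilon> a b)\<bar>"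
        using circle_dist_le[of "\<theta>' $ a" "\<theta>' $ b" 0] by (simp add: \<theta>'_def \<psi>[OF ab])
      ultimately show "circle_dist (\<theta>' $ a) (\<theta>' $ b) \<le> \<gamma> {a, b}" by linarith
    qed
    then have "dispatch_cost N \<alpha> u \<le> dispatch_cost N \<alpha> (\<lambda>k. u k + \<epsilon> * w k)" by (rule minimal)
    also have "\<dots> = dispatch_cost N \<alpha> u + (\<epsilon> * (\<Sum>k\<in>inverters N. \<alpha> k * u k * w k) +
        \<epsilon>\<^sup>2 * (\<Sum>k\<in>inverters N. 1 / 2 * \<alpha> k * (w k)\<^sup>2))"
      unfolding dispatch_cost_def sum_distrib_left sum.distrib[symmetric]
      by (intro sum.cong refl) (simp add: power2_eq_square algebra_simps)
    finally show ?thesis by simp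
  qed
  have "(\<Sum>k\<in>inverters N. \<alpha> k * u k * w k) = 0"
  proof (rule quadratic_nonneg_near_0[OF \<open>\<epsilon>0 > 0\<close> _ cost_le])
    show "0 \<le> (\<Sum>k\<in>inverters N. 1 / 2 * \<alpha> k * (w k)\<^sup>2)"
      using \<alpha> by (intro sum_nonneg mult_nonneg_nonneg) (auto intro: less_imp_le)
  qed
  moreover have "(\<Sum>k\<in>inverters N. \<alpha> k * u k * w k) = \<alpha> i * u i - \<alpha> j * u j"
  proof -
    have "(\<Sum>k\<in>inverters N. \<alpha> k * u k * of_bool (k = l)) = \<alpha> l * u l" if "l \<in> inverters N" for l
      using that by (simp add: of_bool_def if_distrib[of "\<lambda>x. _ * x"] cong: if_cong)
    with i j show ?thesis by (simp add: w_def right_diff_distrib sum_subtractf)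
  qed
  ultimately show ?thesis by simp
qed

section \<open>Passing between optimal dispatch and droop control\<close>

lemma sum_loads_inverters:
  assumes "acyclic_microgrid N"
  shows "(\<Sum>i\<in>UNIV. F i) = (\<Sum>i\<in>loads N. F i) + (\<Sum>i\<in>inverters N. F i)"
  using sum.union_disjoint[of "loads N" "inverters N" F] acyclic_microgridD(1,2)[OF assms] by simp

text \<open>Injections sum to zero, so the balance equations leave no freedom in the total control.
  This identifies the common marginal cost with the frequency and removes the first-order term in
  the convexity argument.\<close>

lemma power_balance_sum_control:
  assumes N: "acyclic_microgrid N" and "power_balance N \<theta> u"
  shows "(\<Sum>i\<in>inverters N. u i) = - (\<Sum>i\<in>UNIV. setpoint N i)"
proof -
  have "(\<Sum>i\<in>inverters N. setpoint N i + u i) = (\<Sum>i\<in>inverters N. power_injection N \<theta> i)"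
    "(\<Sum>i\<in>loads N. setpoint N i) = (\<Sum>i\<in>loads N. power_injection N \<theta> i)"
    using assms(2) unfolding power_balance_def by (auto intro: sum.cong)
  then show ?thesis
    using sum_power_injection[OF N, of \<theta>]
    by (simp add: sum_loads_inverters[OF N] sum.distrib)
qed

text \<open>Ensures that \<open>Max\<close> over the lines is taken over a nonempty set: without a
  line there is no positive injection at an inverter.\<close>

lemma lines_nonempty:
  assumes N: "acyclic_microgrid N" and "\<And>i. i \<in> inverters N \<Longrightarrow> 0 < power_injection N \<theta> i"
  shows "lines N \<noteq> {}"
proof
  assume "lines N = {}"
  then have "power_injection N \<theta> i = 0" for i
    using coupling_eq_0[OF N] by (simp add: power_injection_eq_flow network_flow_def)
  with assms(2) acyclic_microgridD(3)[OF N] show False by fastforce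
qed

lemma optimal_dispatch_imp_sync:
  assumes N: "acyclic_microgrid N" and opt: "strict_optimal_dispatch N \<alpha> \<gamma>AC \<theta> u"
  shows "\<exists>\<gamma> D M. constrained_sync N \<gamma> D M \<and> dispatch_droop_related N \<alpha> \<gamma>AC \<theta> u \<gamma> D M"
proof -
  \<comment> \<open>A common factor in \<open>D\<close> leaves each product
    \<open>D i * sync_freq N D\<close> unchanged; the normalisation here is
    \<open>\<beta> = 1\<close>.\<close>
  define D where "D i = 1 / \<alpha> i" for i
  define \<gamma> where "\<gamma> = Max (\<gamma>AC ` lines N)"
  have \<alpha>: "\<And>i. i \<in> inverters N \<Longrightarrow> \<alpha> i > 0" and \<gamma>AC: "\<And>e. e \<in> lines N \<Longrightarrow> 0 \<le> \<gamma>AC e \<and> \<gamma>AC e < pi / 2"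
    and balance: "power_balance N \<theta> u"
    and close: "\<And>a b. {a, b} \<in> lines N \<Longrightarrow> circle_dist (\<theta> $ a) (\<theta> $ b) < \<gamma>AC {a, b}"
    and rating: "\<And>k. k \<in> inverters N \<Longrightarrow> 0 < power_injection N \<theta> k \<and> power_injection N \<theta> k < rating N k"
    using opt unfolding strict_optimal_dispatch_def dispatch_strictly_feasible_def by simp_all
  have "lines N \<noteq> {}" using lines_nonempty[OF N] rating by blast
  then have "\<gamma> \<in> \<gamma>AC ` lines N" unfolding \<gamma>_def by (intro Max_in) auto
  with \<gamma>AC have \<gamma>: "0 \<le> \<gamma>" "\<gamma> < pi / 2" by auto
  have D: "D i > 0" if "i \<in> inverters N" for i using \<alpha>[OF that] by (simp add: D_def)
  obtain i0 where i0: "i0 \<in> inverters N" using acyclic_microgridD(3)[OF N] by blast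
  define \<nu> where "\<nu> = \<alpha> i0 * u i0"
  have u: "u i = \<nu> * D i" if "i \<in> inverters N" for i
    using strict_optimal_dispatch_marginal_costs[OF N opt that i0] \<alpha>[OF that]
    by (simp add: \<nu>_def D_def field_simps)
  have sum_D: "(\<Sum>i\<in>inverters N. D i) > 0" using i0 D by (intro sum_pos) auto
  \<comment> \<open>Summing the controls determines the common marginal cost \<open>\<nu>\<close>:
    it is minus the synchronization frequency.\<close>
  have "\<nu> * (\<Sum>i\<in>inverters N. D i) = (\<Sum>i\<in>inverters N. u i)"
    unfolding sum_distrib_left by (intro sum.cong refl) (simp add: u)
  also have "\<dots> = - (\<Sum>i\<in>UNIV. setpoint N i)" by (rule power_balance_sum_control[OF N balance])
  finally have "\<nu> = - sync_freq N D" using sum_D by (simp add: sync_freq_def field_simps)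
  with u have u_droop: "u i = - D i * sync_freq N D" if "i \<in> inverters N" for i using that by simp
  have equilibrium: "power_injection N \<theta> i = shifted_injection N D i" for i
  proof (cases "i \<in> inverters N")
    case True
    then have "setpoint N i + u i = power_injection N \<theta> i" using balance by (simp add: power_balance_def)
    with True u_droop[OF True] show ?thesis by (simp add: shifted_injection_def)
  next
    case False
    then have "i \<in> loads N" using acyclic_microgridD(1)[OF N] by blast
    with balance False show ?thesis by (simp add: power_balance_def shifted_injection_def)
  qed
  have "circle_dist (\<theta> $ a) (\<theta> $ b) < \<gamma>" if "{a, b} \<in> lines N" for a b
  proof -
    have "\<gamma>AC {a, b} \<le> \<gamma>" unfolding \<gamma>_def using that by (intro Max_ge) auto
    with close[OF that] show ?thesis by linarith
  qed
  then have cohesive: "\<phi> \<in> cohesive_set N \<gamma>" if "\<phi> \<in> rot_orbit \<theta>" for \<phi>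
    unfolding cohesive_set_def by (simp add: circle_dist_rotate[OF that])
  have unique: "M' = rot_orbit \<theta>" if "equilibrium_manifold N D M'" "M' \<subseteq> cohesive_set N \<gamma>" for M'
  proof -
    from that(1) obtain \<phi> where \<phi>: "M' = rot_orbit \<phi>" unfolding equilibrium_manifold_def by blast
    have "\<phi> \<in> cohesive_set N \<gamma>" using that(2) rot_orbit_refl[of \<phi>] \<phi> by blast
    moreover have "power_injection N \<phi> = power_injection N \<theta>"
      using that(1) equilibrium by (simp add: \<phi> equilibrium_manifold_rot_orbit[OF N] fun_eq_iff)
    ultimately show ?thesis
      using cohesive_flow_unique[OF N \<gamma>] cohesive[OF rot_orbit_refl] \<phi> by blast
  qed
  have "constrained_sync N \<gamma> D (rot_orbit \<theta>)"
    unfolding constrained_sync_def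
  proof (intro conjI ballI allI impI)
    show "equilibrium_manifold N D (rot_orbit \<theta>)"
      using equilibrium by (simp add: equilibrium_manifold_rot_orbit[OF N])
    show "locally_exponentially_stable N D (rot_orbit \<theta>)"
      by (rule cohesive_equilibrium_stable[OF N \<gamma> D cohesive[OF rot_orbit_refl] equilibrium])
    show "rot_orbit \<theta> \<subseteq> cohesive_set N \<gamma>" using cohesive by blast
    show "M' = rot_orbit \<theta>" if "equilibrium_manifold N D M' \<and> M' \<subseteq> cohesive_set N \<gamma>" for M'
      using unique that by blast
    fix \<phi> i assume \<phi>: "\<phi> \<in> rot_orbit \<theta>" and i: "i \<in> inverters N"
    show "0 < power_injection N \<phi> i" "power_injection N \<phi> i < rating N i"
      using rating[OF i] by (simp_all add: power_injection_rotate[OF \<phi>])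
  qed (use \<gamma> D in auto)
  moreover have "dispatch_droop_related N \<alpha> \<gamma>AC \<theta> u \<gamma> D (rot_orbit \<theta>)"
    unfolding dispatch_droop_related_def using u_droop
    by (auto simp: \<gamma>_def D_def intro!: exI[of _ 1])
  ultimately show ?thesis by blast
qed

lemma sync_imp_optimal_dispatch:
  assumes N: "acyclic_microgrid N" and sync: "constrained_sync N \<gamma> D M"
  shows "\<exists>\<alpha> \<gamma>AC \<theta> u. strict_optimal_dispatch N \<alpha> \<gamma>AC \<theta> u \<and>
    dispatch_droop_related N \<alpha> \<gamma>AC \<theta> u \<gamma> D M"
proof -
  have \<gamma>: "0 \<le> \<gamma>" "\<gamma> < pi / 2" and D: "\<And>i. i \<in> inverters N \<Longrightarrow> D i > 0"
    and manifold: "equilibrium_manifold N D M" and cohesive: "M \<subseteq> cohesive_set N \<gamma>"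
    and rating: "\<And>\<theta> i. \<theta> \<in> M \<Longrightarrow> i \<in> inverters N \<Longrightarrow>
      0 < power_injection N \<theta> i \<and> power_injection N \<theta> i < rating N i"
    using sync unfolding constrained_sync_def by simp_all
  obtain \<theta> where \<theta>: "M = rot_orbit \<theta>" using manifold unfolding equilibrium_manifold_def by blast
  have "\<theta> \<in> M" using rot_orbit_refl \<theta> by simp
  have equilibrium: "power_injection N \<theta> i = shifted_injection N D i" for i
    using manifold by (simp add: \<theta> equilibrium_manifold_rot_orbit[OF N])
  define \<alpha> where "\<alpha> i = 1 / D i" for i
  define u where "u i = - D i * sync_freq N D" for i
  have \<alpha>: "\<alpha> i > 0" if "i \<in> inverters N" for i using D[OF that] by (simp add: \<alpha>_def)
  have close: "circle_dist (\<theta> $ a) (\<theta> $ b) < \<gamma>" if "{a, b} \<in> lines N" for a b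
    using cohesive \<open>\<theta> \<in> M\<close> that unfolding cohesive_set_def by blast
  have balance: "power_balance N \<theta> u"
    unfolding power_balance_def equilibrium shifted_injection_def u_def
    using acyclic_microgridD(2)[OF N] by auto
  \<comment> \<open>The same bound on every line, so that the maximum in the asserted relation is
    \<open>\<gamma>\<close>.\<close>
  have strict: "dispatch_strictly_feasible N (\<lambda>e. \<gamma>) \<theta> u"
    using balance close rating[OF \<open>\<theta> \<in> M\<close>] by (simp add: dispatch_strictly_feasible_def)
  then have feasible: "dispatch_feasible N (\<lambda>e. \<gamma>) \<theta> u"
    unfolding dispatch_strictly_feasible_def dispatch_feasible_def by (meson less_imp_le)
  have "dispatch_cost N \<alpha> u \<le> dispatch_cost N \<alpha> u'" if "dispatch_feasible N (\<lambda>e. \<gamma>) \<theta>' u'" for \<theta>' u'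
  proof -
    have "(\<Sum>i\<in>inverters N. u' i) = (\<Sum>i\<in>inverters N. u i)"
      using power_balance_sum_control[OF N] balance that unfolding dispatch_feasible_def by metis
    \<comment> \<open>Every \<open>\<alpha> i * u i\<close> equals \<open>- sync_freq N D\<close>,
      so the linearised cost change is a multiple of the change in total control, which is 0; the
      remaining part of the cost change is a sum of nonnegative squares.\<close>
    then have "0 = - sync_freq N D * (\<Sum>i\<in>inverters N. u' i - u i)" by (simp add: sum_subtractf)
    also have "\<dots> = (\<Sum>i\<in>inverters N. \<alpha> i * u i * (u' i - u i))"
      unfolding sum_distrib_left by (intro sum.cong refl) (auto simp: \<alpha>_def u_def dest!: D)
    also have "\<dots> \<le> (\<Sum>i\<in>inverters N. 1 / 2 * \<alpha> i * (u' i)\<^sup>2 - 1 / 2 * \<alpha> i * (u i)\<^sup>2)"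
    proof (rule sum_mono)
      fix i assume "i \<in> inverters N"
      then have "0 \<le> 1 / 2 * \<alpha> i * (u' i - u i)\<^sup>2" using \<alpha>[of i] by simp
      then show "\<alpha> i * u i * (u' i - u i) \<le> 1 / 2 * \<alpha> i * (u' i)\<^sup>2 - 1 / 2 * \<alpha> i * (u i)\<^sup>2"
        by (simp add: power2_eq_square algebra_simps)
    qed
    finally show ?thesis by (simp add: dispatch_cost_def sum_subtractf)
  qed
  with feasible have "dispatch_minimizer N \<alpha> (\<lambda>e. \<gamma>) \<theta> u" unfolding dispatch_minimizer_def by blast
  with \<alpha> \<gamma> strict have "strict_optimal_dispatch N \<alpha> (\<lambda>e. \<gamma>) \<theta> u"
    unfolding strict_optimal_dispatch_def by blast
  moreover have "dispatch_droop_related N \<alpha> (\<lambda>e. \<gamma>) \<theta> u \<gamma> D M"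
  proof -
    have "lines N \<noteq> {}" using lines_nonempty[OF N] rating[OF \<open>\<theta> \<in> M\<close>] by blast
    then have "(\<lambda>e. \<gamma>) ` lines N = {\<gamma>}" by blast
    then show ?thesis
      unfolding dispatch_droop_related_def by (auto simp: \<theta> u_def \<alpha>_def intro!: exI[of _ 1])
  qed
  ultimately show ?thesis by blast
qed

text \<open>Parameters in (i) and (ii) are not unique, so arbitrary solutions of the two problems
  need not be related. The relations are therefore stated by pairing each solution of either problem
  with a suitable solution of the other.\<close>

theorem theoremV2:
  fixes N :: "'n::finite microgrid"
  assumes "acyclic_microgrid N"
  shows "((\<exists>\<alpha> \<gamma>AC \<theta> u. strict_optimal_dispatch N \<alpha> \<gamma>AC \<theta> u) \<longleftrightarrow>
          (\<exists>\<gamma> D M. constrained_sync N \<gamma> D M)) \<and>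
         (\<forall>\<alpha> \<gamma>AC \<theta> u. strict_optimal_dispatch N \<alpha> \<gamma>AC \<theta> u \<longrightarrow>
            (\<exists>\<gamma> D M. constrained_sync N \<gamma> D M \<and> dispatch_droop_related N \<alpha> \<gamma>AC \<theta> u \<gamma> D M)) \<and>
         (\<forall>\<gamma> D M. constrained_sync N \<gamma> D M \<longrightarrow>
            (\<exists>\<alpha> \<gamma>AC \<theta> u. strict_optimal_dispatch N \<alpha> \<gamma>AC \<theta> u \<and>
                dispatch_droop_related N \<alpha> \<gamma>AC \<theta> u \<gamma> D M))"
proof -
  note imp = optimal_dispatch_imp_sync[OF assms] and conv = sync_imp_optimal_dispatch[OF assms]
  have "(\<exists>\<alpha> \<gamma>AC \<theta> u. strict_optimal_dispatch N \<alpha> \<gamma>AC \<theta> u) \<longleftrightarrow> (\<exists>\<gamma> D M. constrained_sync N \<gamma> D M)"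
    by (meson imp conv)
  with imp conv show ?thesis by blast
qed

end
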